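(* Let $T>0$ and let $\{\varepsilon_n\}$ be a sequence of positive numbers converging to $0$ such that $\{u^{\varepsilon_n}\}$ converges to some $u$ uniformly on $[0,T]$, with $\inf_{t\in[0,T]}u(t)>\rho$. Then there exists $z_0>0$ such that for all $z\in(0,z_0)$ $$\sup_{n\ge0}\ \sup_{t\in[0,T]}F^{\varepsilon_n}(t,z)<\infty,\qquad\text{where } F^\varepsilon(t,z)=\sum_{j\ge2}\varepsilon^{r_a}c_j^\varepsilon(t)e^{-jz}.$$ In particular, for all $r\ge r_a$ and $i\ge2$, $$\sup_{n\ge0}\ \sup_{t\in[0,T]}\ \varepsilon_n^{\,r}c_i^{\varepsilon_n}(t)<+\infty.$$
   Context: **Rescaled Becker–Döring (BD) system.** Fix $\eta\ge 0$. For each $\varepsilon>0$ let $\alpha^\varepsilon,\beta^\varepsilon,(a_i^\varepsilon)_{i\ge2},(b_i^\varepsilon)_{i\ge3}$ be positive numbers for which there is a constant $K(\varepsilon)>0$ with $a_{i+1}^\varepsilon-a_i^\varepsilon\le K(\varepsilon)$ ($i\ge2$) and $b_i^\varepsilon-b_{i+1}^\varepsilon\le K(\varepsilon)$ ($i\ge3$). Let $u^\varepsilon$ and $(c_i^\varepsilon)_{i\ge2}$ be non-negative functions in $\mathcal C([0,+\infty))$ forming a global solution of $$\frac{d}{dt}u^\varepsilon=-\varepsilon J_1^\varepsilon-\varepsilon\sum_{i\ge1}J_i^\varepsilon,\qquad \frac{d}{dt}c_i^\varepsilon=\frac1\varepsilon\big[J_{i-1}^\varepsilon-J_i^\varepsilon\big]\quad(i\ge2),$$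 $$J_1^\varepsilon=\alpha^\varepsilon(u^\varepsilon)^2-\varepsilon^\eta\beta^\varepsilon c_2^\varepsilon,\qquad J_i^\varepsilon=a_i^\varepsilon u^\varepsilon c_i^\varepsilon-b_{i+1}^\varepsilon c_{i+1}^\varepsilon\quad(i\ge2),$$ with non-negative initial data $u^{{\rm in},\varepsilon},(c_i^{{\rm in},\varepsilon})_{i\ge2}$, and satisfying the mass balance $u^\varepsilon(t)+\sum_{i\ge2}\varepsilon^2 i\,c_i^\varepsilon(t)=m^\varepsilon$ for all $t\ge0$, with $m^\varepsilon<\infty$ constant. Put $\Lambda_i^\varepsilon=[(i-\frac12)\varepsilon,(i+\frac12)\varepsilon)$ and $$f^\varepsilon(t,x)=\sum_{i\ge2}c_i^\varepsilon(t)\mathbf 1_{\Lambda_i^\varepsilon}(x),\quad f^{{\rm in},\varepsilon}=f^\varepsilon(0,\cdot),\quad a^\varepsilon(x)=\sum_{i\ge2}a_i^\varepsilon\mathbf 1_{\Lambda_i^\varepsilon}(x),\quad b^\varepsilon(x)=\sum_{i\ge3}b_i^\varepsilon\mathbf 1_{\Lambda_i^\varepsilon}(x).$$ **Assumptions on the rates.** $\alpha,\beta>0$; $a,b$ are non-negative continuous functions on $[0,+\infty)$, positive on $(0,+\infty)$. As $\varepsilon\to0$: $\alpha^\varepsilon\to\alpha$, $\beta^\varepsilon\to\beta$, and $a^\varepsilon\to a$, $b^\varepsilon\to b$ uniformly on compact subsets of $[0,+\infty)$. There are $K_a,K_b>0$ with $a^\varepsilon(x)\le K_a(1+x)$ and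 $b^\varepsilon(x)\le K_b(1+x)$ for all $x\ge0$, $\varepsilon>0$. There are $r_a\in[0,1)$, $r_b\ge r_a$, $\overline a>0$, $\overline b>0$ with $a(x)\sim_{0^+}\overline a x^{r_a}$, $b(x)\sim_{0^+}\overline b x^{r_b}$, and $a^\varepsilon(\varepsilon i)=a(\varepsilon i)+o((\varepsilon i)^{r_a})$, $b^\varepsilon(\varepsilon i)=b(\varepsilon i)+o((\varepsilon i)^{r_b})$, where the Landau symbol refers to $\varepsilon i\to0$ ($i\ge2$ for $a$, $i\ge3$ for $b$). Set $\rho:=\lim_{x\to0^+}b(x)/a(x)=\lim_{x\to 0^+}\frac{\overline b}{\overline a}x^{r_b-r_a}\in[0,+\infty)$. **Assumptions on the initial data.** $\mathcal M_f(U)$ is the set of non-negative finite regular Borel measures on $U$, with the weak-$*$ topology: $\nu^n\to\nu$ iff $\int\varphi\,d\nu^n\to\int\varphi\,d\nu$ for all $\varphi\in\mathcal C_c(U)$; a density $f$ is identified with $f(x)dx$. There are $u^{\rm in}>\rho$ and $\mu^{\rm in}\in\mathcal M_f([0,+\infty))$ such that, as $\varepsilon\to0$, $u^{{\rm in},\varepsilon}\to u^{\rm in}$ and $f^{{\rm in},\varepsilon}\to\mu^{\rm in}$ weak-$*$ in $\mathcal M_f([0,+\infty))$. Let $\mathcal U$ be the set of non-negative convex functions $\Phi\in\mathcal C^1([0,+\infty))$, piecewise $\mathcal C^2$, with $\Phi(0)=0$, $\Phi'$ concave, $\Phi'(0)\ge0$, $\Phi(x)/x\to+\infty$ as $x\to+\infty$.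 There is $\Phi\in\mathcal U$ with $\sup_{\varepsilon>0}\int_0^\infty\Phi(x)f^{{\rm in},\varepsilon}(x)dx<\infty$. For all $z\in(0,1)$, $\sup_{\varepsilon>0}\sum_{i\ge2}\varepsilon^{r_a}c_i^{{\rm in},\varepsilon}e^{-iz}<\infty$. *)

theory Defs
  imports "HOL-Analysis.Analysis" "HOL-Library.Landau_Symbols"
begin

unbundle asymp_equiv_syntax

text \<open>For one fixed value of the scaling parameter: \<open>i = 1\<close> is the nucleation flux; cluster sizes
  \<open>i\<close> of \<open>c\<close> and of the rates \<open>a\<close> start at 2, those of the rates \<open>b\<close> at 3, and values at smaller
  indices are never used.\<close>

definition BD_flux ::
  "real \<Rightarrow> real \<Rightarrow> real \<Rightarrow> real \<Rightarrow> (nat \<Rightarrow> real) \<Rightarrow> (nat \<Rightarrow> real) \<Rightarrow>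
   (real \<Rightarrow> real) \<Rightarrow> (nat \<Rightarrow> real \<Rightarrow> real) \<Rightarrow> nat \<Rightarrow> real \<Rightarrow> real"
  where "BD_flux \<eta> \<epsilon> \<alpha> \<beta> a b u c i t =
    (if i = 1 then \<alpha> * (u t)\<^sup>2 - \<epsilon> powr \<eta> * \<beta> * c 2 t
     else a i * u t * c i t - b (i + 1) * c (i + 1) t)"

text \<open>The equations hold at every \<open>t \<ge> 0\<close> (one-sided derivative at 0). Since the mass is finite and
  constant, the series of fluxes is locally uniformly convergent when the rates grow at most
  linearly, so this classical notion agrees with the time-integrated one. The clauses on summability
  exclude the default values of divergent sums.\<close>

definition BD_solution ::
  "real \<Rightarrow> real \<Rightarrow> real \<Rightarrow> real \<Rightarrow> (nat \<Rightarrow> real) \<Rightarrow> (nat \<Rightarrow> real) \<Rightarrow>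
   (real \<Rightarrow> real) \<Rightarrow> (nat \<Rightarrow> real \<Rightarrow> real) \<Rightarrow> real \<Rightarrow> bool"
  where "BD_solution \<eta> \<epsilon> \<alpha> \<beta> a b u c m \<longleftrightarrow>
    continuous_on {0..} u \<and> (\<forall>i\<ge>2. continuous_on {0..} (c i)) \<and>
    (\<forall>t\<ge>0. u t \<ge> 0) \<and> (\<forall>i\<ge>2. \<forall>t\<ge>0. c i t \<ge> 0) \<and>
    (\<forall>t\<ge>0. summable (\<lambda>i. BD_flux \<eta> \<epsilon> \<alpha> \<beta> a b u c (i + 1) t)) \<and>
    (\<forall>t\<ge>0. (u has_real_derivative
        (- \<epsilon> * BD_flux \<eta> \<epsilon> \<alpha> \<beta> a b u c 1 t
         - \<epsilon> * (\<Sum>i. BD_flux \<eta> \<epsilon> \<alpha> \<beta> a b u c (i + 1) t))) (at t within {0..})) \<and>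
    (\<forall>i\<ge>2. \<forall>t\<ge>0. (c i has_real_derivative
        1 / \<epsilon> * (BD_flux \<eta> \<epsilon> \<alpha> \<beta> a b u c (i - 1) t - BD_flux \<eta> \<epsilon> \<alpha> \<beta> a b u c i t))
        (at t within {0..})) \<and>
    (\<forall>t\<ge>0. (\<lambda>i. \<epsilon>\<^sup>2 * real i * c i t) summable_on {2..} \<and>
        u t + (\<Sum>\<^sub>\<infinity>i\<in>{2..}. \<epsilon>\<^sup>2 * real i * c i t) = m)"

definition cell :: "real \<Rightarrow> nat \<Rightarrow> real set"
  where "cell \<epsilon> i = {(real i - 1/2) * \<epsilon> ..< (real i + 1/2) * \<epsilon>}"

text \<open>The function equal to \<open>v i\<close> on \<open>cell \<epsilon> i\<close> for \<open>i \<ge> k\<close> and zero elsewhere; for \<open>\<epsilon> > 0\<close> the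
  cells are disjoint, so at most one term is non-zero at each \<open>x\<close>.\<close>

definition step_fun :: "nat \<Rightarrow> real \<Rightarrow> (nat \<Rightarrow> real) \<Rightarrow> real \<Rightarrow> real"
  where "step_fun k \<epsilon> v x = (\<Sum>\<^sub>\<infinity>i\<in>{k..}. v i * indicator (cell \<epsilon> i) x)"

text \<open>\<open>F\<^sup>\<epsilon>(t,z)\<close>, in \<open>[0,\<infinity>]\<close> so that finiteness of a supremum includes convergence of the series.\<close>

definition BD_F :: "real \<Rightarrow> real \<Rightarrow> (nat \<Rightarrow> real \<Rightarrow> real) \<Rightarrow> real \<Rightarrow> real \<Rightarrow> ennreal"
  where "BD_F r \<epsilon> c t z =
    (\<Sum>\<^sub>\<infinity>j\<in>{2..}. ennreal (\<epsilon> powr r * c j t * exp (- real j * z)))"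

text \<open>The filter on pairs \<open>(\<epsilon>, i)\<close> with \<open>\<epsilon> > 0\<close> and \<open>i \<ge> k\<close> describing \<open>\<epsilon> i \<rightarrow> 0\<close>, uniformly in the
  way \<open>\<epsilon>\<close> and \<open>i\<close> vary.\<close>

definition size_to_0 :: "nat \<Rightarrow> (real \<times> nat) filter"
  where "size_to_0 k =
    inf (filtercomap (\<lambda>(\<epsilon>, i). \<epsilon> * real i) (at_right 0)) (principal {(\<epsilon>, i). 0 < \<epsilon> \<and> k \<le> i})"

text \<open>On subsets of the real line such as \<open>[0,\<infinity>)\<close> every finite Borel measure is regular.\<close>

definition finite_borel_measures :: "real set \<Rightarrow> real measure set"
  where "finite_borel_measures U =
    {\<nu>. sets \<nu> = sets (restrict_space borel U) \<and> finite_measure \<nu>}"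

definition density_on :: "real set \<Rightarrow> (real \<Rightarrow> real) \<Rightarrow> real measure"
  where "density_on U f = density (restrict_space lborel U) (\<lambda>x. ennreal (f x))"

definition weak_star_tendsto ::
  "real set \<Rightarrow> ('i \<Rightarrow> real measure) \<Rightarrow> real measure \<Rightarrow> 'i filter \<Rightarrow> bool"
  where "weak_star_tendsto U \<nu> \<mu> F \<longleftrightarrow>
    (\<forall>\<phi>::real \<Rightarrow> real.
       continuous_on U \<phi> \<and> (\<exists>K. compact K \<and> K \<subseteq> U \<and> (\<forall>x\<in>U - K. \<phi> x = 0)) \<longrightarrow>
       ((\<lambda>\<epsilon>. \<integral>x. \<phi> x \<partial>(\<nu> \<epsilon>)) \<longlongrightarrow> (\<integral>x. \<phi> x \<partial>\<mu>)) F)"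

text \<open>The class \<open>\<U>\<close>; functions on \<open>[0,\<infinity>)\<close> are represented by functions on the reals whose values at
  negative arguments are irrelevant. ``Piecewise \<open>C\<^sup>2\<close>'' on \<open>[0,\<infinity>)\<close> allows finitely many break points
  in each bounded interval.\<close>

definition superlinear_class :: "(real \<Rightarrow> real) set"
  where "superlinear_class =
    {\<Phi>. (\<forall>x\<ge>0. \<Phi> x \<ge> 0) \<and> convex_on {0..} \<Phi> \<and> \<Phi> 0 = 0 \<and>
        (\<exists>\<Phi>'. (\<forall>x\<ge>0. (\<Phi> has_real_derivative \<Phi>' x) (at x within {0..})) \<and>
              continuous_on {0..} \<Phi>' \<and>
              (\<forall>R>0. \<Phi>' piecewise_C1_differentiable_on {0..R}) \<and>
              concave_on {0..} \<Phi>' \<and> \<Phi>' 0 \<ge> 0) \<and>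
        filterlim (\<lambda>x. \<Phi> x / x) at_top at_top}"

end

theory Submission
  imports Defs
begin

text \<open>
  Write \<open>G(t) = \<Sum>j\<ge>2. \<epsilon>\<^sup>r c\<^sub>j(t) exp (-j z)\<close> with \<open>r = r\<^sub>a\<close>. Summation by parts turns the evolution
  equations into
  \<open>\<epsilon> (\<Sum>j. c\<^sub>j exp (-j z))' \<le> \<alpha> u\<^sup>2 - (1 - exp (-z)) (\<Sum>j. (u a\<^sub>j - exp z b\<^sub>j) c\<^sub>j exp (-j z))\<close>,
  where the term of \<open>b\<^sub>2\<close> is absent. Near size zero the ratio \<open>b / a\<close> is close to \<open>\<rho>\<close>, and \<open>u\<close> stays above
  \<open>\<rho>\<close>, so for \<open>z\<close> small the net growth coefficient \<open>u a\<^sub>j - exp z b\<^sub>j\<close> of the clusters with \<open>\<epsilon> j < \<delta>\<close>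
  is at least a constant times \<open>(\<epsilon> j)\<^sup>r \<ge> \<epsilon>\<^sup>r\<close> (lemma \<open>small_cluster_net_growth\<close>). Hence
  \<open>G' \<le> \<epsilon>\<^sup>r\<^sup>-\<^sup>1 (P - \<theta> G)\<close> with \<open>\<theta> > 0\<close> and \<open>P\<close> independent of \<open>\<epsilon>\<close>. The factor \<open>\<epsilon>\<^sup>r\<^sup>-\<^sup>1\<close> changes only
  the speed of the relaxation: \<open>G\<close> never exceeds the larger of \<open>G(0)\<close> and \<open>P / \<theta>\<close>.

  It remains to absorb the clusters with \<open>\<epsilon> j \<ge> \<delta>\<close> into \<open>P\<close>. There \<open>exp (-j z) \<le> exp (-\<delta> z / \<epsilon>)\<close>, and
  everything else is at most linear in \<open>j c\<^sub>j\<close>, so their contribution is of order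
  \<open>m / \<epsilon> exp (-\<delta> z / \<epsilon>)\<close>, where \<open>m\<close> is the conserved mass. A bound \<open>m = O(exp (\<kappa> / \<epsilon>))\<close> with
  \<open>\<kappa> < \<delta> z\<close> is therefore enough, and it can be read off at time zero
  (lemma \<open>initial_mass_subexponential\<close>).

  The differential inequality is proved for the sums over \<open>2 \<le> j \<le> N\<close>, with a bound independent of
  large \<open>N\<close> (lemma \<open>truncated_generating_function_bound\<close>), so that no series has to be differentiated;
  the flux leaving the truncation is one more large-cluster term.
\<close>

section \<open>Relaxation inequalities\<close>

text \<open>The function \<open>(y - B) exp (l t)\<close> is nonincreasing and starts at a nonpositive value.\<close>
lemma le_of_relaxation_inequality:
  fixes y :: "real \<Rightarrow> real"
  assumes deriv: "\<And>t. 0 \<le> t \<Longrightarrow> t \<le> T \<Longrightarrow>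
      \<exists>D. (y has_real_derivative D) (at t within {0..}) \<and> D \<le> l * (B - y t)"
    and init: "y 0 \<le> B" and t: "0 \<le> t" "t \<le> T"
  shows "y t \<le> B"
proof -
  define w where "w s = (y s - B) * exp (l * s)" for s
  have w': "\<exists>D\<le>0. (w has_real_derivative D) (at s within {0..})"
    if s: "0 \<le> s" "s \<le> t" for s
  proof -
    obtain D where D: "(y has_real_derivative D) (at s within {0..})" "D \<le> l * (B - y s)"
      using deriv[OF s(1) order_trans[OF s(2) t(2)]] by blast
    have "(w has_real_derivative (D - l * (B - y s)) * exp (l * s)) (at s within {0..})"
      unfolding w_def using D(1) by (auto intro!: derivative_eq_intros simp: algebra_simps)
    moreover have "(D - l * (B - y s)) * exp (l * s) \<le> 0"
      using D(2) by (intro mult_nonpos_nonneg) auto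
    ultimately show ?thesis by blast
  qed
  have "w t \<le> w 0"
  proof (rule DERIV_nonpos_imp_decreasing_open[OF \<open>0 \<le> t\<close>])
    fix s assume s: "0 < s" "s < t"
    have "at s within {0..} = at s"
      using s by (intro at_within_interior) auto
    then show "\<exists>d. (w has_real_derivative d) (at s) \<and> d \<le> 0"
      using w'[of s] s by auto
  next
    have "continuous (at s within {0..}) w" if "s \<in> {0..t}" for s
      using w'[of s] that by (auto intro: DERIV_continuous)
    then show "continuous_on {0..t} w"
      unfolding continuous_on_eq_continuous_within
      by (meson atLeastAtMost_iff atLeast_iff continuous_within_subset subsetI)
  qed
  also have "w 0 \<le> 0" using init by (simp add: w_def)
  finally show ?thesis by (simp add: w_def mult_le_0_iff)
qed

section \<open>Step functions and the limit of vanishing size\<close>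

lemma step_fun_midpoint:
  assumes "\<epsilon> > 0" "k \<le> i"
  shows "step_fun k \<epsilon> v (\<epsilon> * real i) = v i"
proof -
  have mem: "\<epsilon> * real i \<in> cell \<epsilon> j \<longleftrightarrow> j = i" for j
  proof -
    have "\<epsilon> * real i \<in> cell \<epsilon> j \<longleftrightarrow> real j - 1/2 \<le> real i \<and> real i < real j + 1/2"
      using assms(1) by (simp add: cell_def mult.commute[of \<epsilon>])
    then show ?thesis by auto
  qed
  have "step_fun k \<epsilon> v (\<epsilon> * real i) = (\<Sum>\<^sub>\<infinity>j\<in>{i}. v j * indicator (cell \<epsilon> j) (\<epsilon> * real i))"
    unfolding step_fun_def using assms(2) by (intro infsum_cong_neutral) (auto simp: mem)
  then show ?thesis by (simp add: mem)
qed

lemma step_fun_on_cell: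
  assumes "\<epsilon> > 0" "k \<le> i" and x: "x \<in> cell \<epsilon> i"
  shows "step_fun k \<epsilon> v x = v i"
proof -
  have mem: "x \<in> cell \<epsilon> j \<longleftrightarrow> j = i" for j
  proof -
    have "x \<in> cell \<epsilon> j \<longleftrightarrow> real j - 1/2 \<le> x / \<epsilon> \<and> x / \<epsilon> < real j + 1/2" for j
      using assms(1) by (simp add: cell_def field_simps)
    with x show ?thesis by auto
  qed
  have "step_fun k \<epsilon> v x = (\<Sum>\<^sub>\<infinity>j\<in>{i}. v j * indicator (cell \<epsilon> j) x)"
    unfolding step_fun_def using assms(2) by (intro infsum_cong_neutral) (auto simp: mem)
  then show ?thesis by (simp add: mem)
qed

text \<open>Restates an \<open>o\<close>-assumption on the rates as an estimate valid for all clusters of size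
  \<open>\<epsilon> j < \<delta>\<close>, uniformly in \<open>\<epsilon>\<close>.\<close>

lemma eventually_size_to_0:
  "eventually P (size_to_0 k) \<longleftrightarrow>
    (\<exists>\<delta>>0. \<forall>\<epsilon>>0. \<forall>i\<ge>k. 0 < \<epsilon> * real i \<longrightarrow> \<epsilon> * real i < \<delta> \<longrightarrow> P (\<epsilon>, i))" (is "_ \<longleftrightarrow> ?R")
proof
  assume "eventually P (size_to_0 k)"
  then obtain Q where Q: "eventually Q (at_right (0::real))"
    and QP: "\<And>\<epsilon> i. Q (\<epsilon> * real i) \<Longrightarrow> 0 < \<epsilon> \<Longrightarrow> k \<le> i \<Longrightarrow> P (\<epsilon>, i)"
    unfolding size_to_0_def eventually_inf_principal eventually_filtercomap by fastforce
  from Q obtain \<delta> where "\<delta> > 0" "\<And>y. 0 < y \<Longrightarrow> y < \<delta> \<Longrightarrow> Q y"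
    unfolding eventually_at_right_field by auto
  then show ?R using QP by (metis mult_pos_pos)
next
  assume ?R
  then obtain \<delta> where "\<delta> > 0"
    and d: "\<And>\<epsilon> i. \<epsilon> > 0 \<Longrightarrow> i \<ge> k \<Longrightarrow> 0 < \<epsilon> * real i \<Longrightarrow> \<epsilon> * real i < \<delta> \<Longrightarrow> P (\<epsilon>, i)" by blast
  have "eventually (\<lambda>x. 0 < x \<and> x < \<delta>) (at_right (0::real))"
    using \<open>\<delta> > 0\<close> unfolding eventually_at_right_field by auto
  then show "eventually P (size_to_0 k)"
    unfolding size_to_0_def eventually_inf_principal eventually_filtercomap
    using d by (intro exI[of _ "\<lambda>x. 0 < x \<and> x < \<delta>"]) auto
qed

section \<open>The truncated generating function\<close>

text \<open>Summation by parts, with the growth part \<open>g\<close> and the fragmentation part \<open>h\<close> of the flux collected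
  at the same cluster size: shifting the index of \<open>h\<close> costs the factor \<open>w = 1 / q\<close>. The last two terms
  are what remains at the upper end. The convention \<open>h 2 = 0\<close> lets one sum cover both parts, since
  the fragmentation of clusters of size 2 belongs to the nucleation flux \<open>J 1\<close>.\<close>

lemma sum_flux_differences:
  fixes J g h :: "nat \<Rightarrow> real" and q w :: real
  assumes J: "\<And>j. j \<ge> 2 \<Longrightarrow> J j = g j - h (j + 1)" and h2: "h 2 = 0"
    and wq: "w * q = 1" and N: "N \<ge> 2"
  shows "(\<Sum>j=2..N. (J (j - 1) - J j) * q ^ j) =
    J 1 * q\<^sup>2 - (1 - q) * (\<Sum>j=2..N. (g j - w * h j) * q ^ j)
    - q ^ (N + 1) * g N + q ^ N * h (N + 1)"
  using N
proof (induction N rule: nat_induct_at_least)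
  case base
  have J2: "J 2 = g 2 - h 3" using J[of 2] by simp
  have "(J 1 - (g 2 - h 3)) * q\<^sup>2 = J 1 * q\<^sup>2 - (1 - q) * (g 2 * q\<^sup>2) - q ^ 3 * g 2 + q\<^sup>2 * h 3"
    by (simp add: power2_eq_square power3_eq_cube algebra_simps)
  then show ?case using h2 J2 by (simp flip: numeral_3_eq_3)
next
  case (Suc n)
  define S where "S = (\<Sum>j=2..n. (g j - w * h j) * q ^ j)"
  have "(\<Sum>j=2..Suc n. (J (j - 1) - J j) * q ^ j)
     = (g n - h (n + 1) - g (n + 1) + h (n + 2)) * q ^ (n + 1)
      + (J 1 * q\<^sup>2 - (1 - q) * S - q ^ (n + 1) * g n + q ^ n * h (n + 1))"
    using Suc.hyps J[of n] J[of "n + 1"] Suc.IH by (simp add: sum.nat_ivl_Suc' S_def)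
  also have "\<dots> = J 1 * q\<^sup>2 - (1 - q) * ((g (n + 1) - w * h (n + 1)) * q ^ (n + 1) + S)
      - q ^ (n + 2) * g (n + 1) + q ^ (n + 1) * h (n + 2)"
  proof -
    have "w * h (n + 1) * q ^ (n + 1) = (w * q) * (h (n + 1) * q ^ n)" by (simp add: mult_ac)
    then have "(g (n + 1) - w * h (n + 1)) * q ^ (n + 1) = g (n + 1) * q ^ (n + 1) - h (n + 1) * q ^ n"
      by (simp only: wq mult_1_left left_diff_distrib)
    then show ?thesis by (simp only:) (simp add: algebra_simps)
  qed
  finally show ?case using Suc.hyps by (simp add: sum.nat_ivl_Suc' S_def)
qed

lemma BD_solution_mass_partial:
  assumes sol: "BD_solution \<eta> \<epsilon> \<alpha> \<beta> a b u c m" and t: "t \<ge> 0"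
    and A: "finite A" "A \<subseteq> {2..}"
  shows "u t + (\<Sum>j\<in>A. \<epsilon>\<^sup>2 * real j * c j t) \<le> m"
proof -
  have s: "(\<lambda>i. \<epsilon>\<^sup>2 * real i * c i t) summable_on {2..}"
    and m: "u t + (\<Sum>\<^sub>\<infinity>i\<in>{2..}. \<epsilon>\<^sup>2 * real i * c i t) = m"
    and c: "\<And>i. i \<ge> 2 \<Longrightarrow> c i t \<ge> 0"
    using sol t unfolding BD_solution_def by auto
  have "(\<Sum>j\<in>A. \<epsilon>\<^sup>2 * real j * c j t) \<le> (\<Sum>\<^sub>\<infinity>i\<in>{2..}. \<epsilon>\<^sup>2 * real i * c i t)"
    using s A c by (intro finite_sum_le_infsum) auto
  with m show ?thesis by linarith
qed

text \<open>Two loss terms are discarded because of their sign: the dissociation part of the nucleation flux,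
  and what the growth of clusters of size \<open>N\<close> contributes at the upper end.\<close>

lemma truncated_generating_function_deriv:
  assumes sol: "BD_solution \<eta> \<epsilon> \<alpha> \<beta> a b u c m" and t: "t \<ge> 0" and N: "N \<ge> 2" and "\<epsilon> > 0"
    and "\<beta> \<ge> 0" and a: "\<And>j. j \<ge> 2 \<Longrightarrow> a j \<ge> 0"
  defines "b' \<equiv> (\<lambda>j. if j = 2 then 0 else b j)"
  shows "\<exists>D. ((\<lambda>t. \<Sum>j=2..N. c j t * exp (- real j * z)) has_real_derivative D) (at t within {0..}) \<and>
    \<epsilon> * D \<le> \<alpha> * (u t)\<^sup>2 * exp (- 2 * z)
      - (1 - exp (- z)) * (\<Sum>j=2..N. (u t * a j - exp z * b' j) * c j t * exp (- real j * z))
      + b (N + 1) * c (N + 1) t * exp (- real N * z)"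
proof -
  define q where "q = exp (- z)"
  define J where "J i = BD_flux \<eta> \<epsilon> \<alpha> \<beta> a b u c i t" for i
  define g where "g i = a i * u t * c i t" for i
  define h where "h i = b' i * c i t" for i
  have q: "exp (- real j * z) = q ^ j" for j
    by (simp add: q_def flip: exp_of_nat_mult)
  have q2: "exp (- 2 * z) = q ^ 2" using q[of 2] by simp
  have c: "\<And>i. i \<ge> 2 \<Longrightarrow> c i t \<ge> 0" and u: "u t \<ge> 0"
    and c': "\<And>i. i \<ge> 2 \<Longrightarrow> (c i has_real_derivative 1 / \<epsilon> * (J (i - 1) - J i)) (at t within {0..})"
    using sol t unfolding BD_solution_def J_def by auto
  let ?D = "\<Sum>j=2..N. 1 / \<epsilon> * (J (j - 1) - J j) * exp (- real j * z)"
  have D: "((\<lambda>t. \<Sum>j=2..N. c j t * exp (- real j * z)) has_real_derivative ?D) (at t within {0..})"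
    by (intro DERIV_sum DERIV_cmult_right c') auto
  have "\<epsilon> * ?D = (\<Sum>j=2..N. (J (j - 1) - J j) * q ^ j)"
    unfolding q sum_distrib_left using \<open>\<epsilon> > 0\<close> by (intro sum.cong) auto
  also have "\<dots> = J 1 * q\<^sup>2 - (1 - q) * (\<Sum>j=2..N. (g j - exp z * h j) * q ^ j)
      - q ^ (N + 1) * g N + q ^ N * h (N + 1)"
    by (rule sum_flux_differences[OF _ _ _ N])
       (auto simp: J_def g_def h_def b'_def BD_flux_def q_def simp flip: exp_add)
  also have "\<dots> \<le> \<alpha> * (u t)\<^sup>2 * q\<^sup>2 - (1 - q) * (\<Sum>j=2..N. (g j - exp z * h j) * q ^ j)
      + q ^ N * h (N + 1)"
  proof -
    have "J 1 \<le> \<alpha> * (u t)\<^sup>2" using c[of 2] \<open>\<beta> \<ge> 0\<close> by (simp add: J_def BD_flux_def)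
    then have "J 1 * q\<^sup>2 \<le> \<alpha> * (u t)\<^sup>2 * q\<^sup>2" by (intro mult_right_mono) auto
    moreover have "q ^ (N + 1) * g N \<ge> 0"
      using a[OF N] c[OF N] u by (simp add: g_def q_def)
    ultimately show ?thesis by linarith
  qed
  also have "(\<Sum>j=2..N. (g j - exp z * h j) * q ^ j)
      = (\<Sum>j=2..N. (u t * a j - exp z * b' j) * c j t * exp (- real j * z))"
    unfolding q g_def h_def by (intro sum.cong) (auto simp: algebra_simps)
  also have "h (N + 1) = b (N + 1) * c (N + 1) t" using N by (auto simp: h_def b'_def)
  finally have "\<epsilon> * ?D \<le> \<alpha> * (u t)\<^sup>2 * exp (- 2 * z)
      - (1 - exp (- z)) * (\<Sum>j=2..N. (u t * a j - exp z * b' j) * c j t * exp (- real j * z))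
      + b (N + 1) * c (N + 1) t * exp (- real N * z)"
    unfolding q2 q[of N] by (simp add: q_def mult_ac)
  with D show ?thesis by blast
qed

text \<open>The relaxation argument. Clusters with \<open>\<epsilon> j < \<delta>\<close> provide the decay rate \<open>k \<epsilon>\<^sup>r\<close>. For all the others
  the linear growth of \<open>b\<close> shows that missing this rate costs at most \<open>L \<epsilon> j c\<^sub>j\<close>, where
  \<open>L = (k + exp z K (1 + \<delta>)) / \<delta>\<close>, times the weight \<open>exp (-\<delta> z / \<epsilon>)\<close>; summed with the mass balance this
  is at most \<open>L Q\<close>. It occurs twice in the bound, once for the sum and once for the clusters of
  size \<open>N + 1\<close> that fragment into the truncation.\<close>

lemma truncated_generating_function_bound:
  fixes \<epsilon> \<delta> k z U A K r B Q :: real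
  assumes sol: "BD_solution \<eta> \<epsilon> \<alpha> \<beta> a b u c m" and \<epsilon>: "0 < \<epsilon>" "\<epsilon> \<le> 1"
    and "\<beta> \<ge> 0" and a: "\<And>j. j \<ge> 2 \<Longrightarrow> a j \<ge> 0" and z: "z > 0" and \<delta>: "\<delta> > 0" and k: "k > 0"
    and A: "0 \<le> \<alpha>" "\<alpha> \<le> A" and U: "\<And>t. 0 \<le> t \<Longrightarrow> t \<le> T \<Longrightarrow> u t \<le> U"
    and K: "K \<ge> 0" "\<And>j. j \<ge> 3 \<Longrightarrow> b j \<le> K * (1 + \<epsilon> * real j)" and r: "r \<ge> 0"
    and small: "\<And>t j. 0 \<le> t \<Longrightarrow> t \<le> T \<Longrightarrow> j \<ge> 2 \<Longrightarrow> \<epsilon> * real j < \<delta> \<Longrightarrow>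
        u t * a j - exp z * (if j = 2 then 0 else b j) \<ge> k * \<epsilon> powr r"
    and Q: "m / \<epsilon> * exp (- \<delta> * z / \<epsilon>) \<le> Q"
    and N: "N \<ge> 2" "\<epsilon> * real N \<ge> \<delta>"
    and init: "(\<Sum>j=2..N. \<epsilon> powr r * c j 0 * exp (- real j * z)) \<le> B"
    and B: "(A * U\<^sup>2 + 2 * ((k + exp z * K * (1 + \<delta>)) / \<delta>) * Q) / ((1 - exp (- z)) * k) \<le> B"
    and t: "0 \<le> t" "t \<le> T"
  shows "(\<Sum>j=2..N. \<epsilon> powr r * c j t * exp (- real j * z)) \<le> B"
proof -
  define L where "L = (k + exp z * K * (1 + \<delta>)) / \<delta>"
  define E where "E = exp (- \<delta> * z / \<epsilon>)"
  define \<theta> where "\<theta> = (1 - exp (- z)) * k"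
  define b' where "b' = (\<lambda>j::nat. if j = 2 then 0 else b j)"
  define F where "F t = (\<Sum>j=2..N. c j t * exp (- real j * z))" for t
  define p where "p = \<epsilon> powr r"
  have p: "0 < p" "p \<le> 1" using \<epsilon> r powr_le1[of r \<epsilon>] by (auto simp: p_def)
  have \<theta>: "\<theta> > 0" using z k by (simp add: \<theta>_def)
  have L: "L > 0" using k K \<delta> by (auto simp: L_def intro!: divide_pos_pos add_pos_nonneg)
  have E: "E > 0" by (simp add: E_def)
  have c: "\<And>i t. i \<ge> 2 \<Longrightarrow> t \<ge> 0 \<Longrightarrow> c i t \<ge> 0" and u0: "\<And>t. t \<ge> 0 \<Longrightarrow> u t \<ge> 0"
    using sol unfolding BD_solution_def by auto
  have mass: "(\<Sum>j\<in>S. L * E * (\<epsilon> * real j * c j t)) \<le> L * Q"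
    if "t \<ge> 0" "finite S" "S \<subseteq> {2..}" for t S
  proof -
    have "\<epsilon> * (\<Sum>j\<in>S. \<epsilon> * real j * c j t) \<le> m"
      using BD_solution_mass_partial[OF sol that] u0[OF that(1)]
      by (simp add: sum_distrib_left power2_eq_square mult_ac)
    then have "(\<Sum>j\<in>S. \<epsilon> * real j * c j t) \<le> m / \<epsilon>" using \<epsilon> by (simp add: field_simps)
    then have "(\<Sum>j\<in>S. \<epsilon> * real j * c j t) * E \<le> m / \<epsilon> * E" using E by (intro mult_right_mono) auto
    also have "\<dots> \<le> Q" using Q by (simp add: E_def)
    finally have "L * ((\<Sum>j\<in>S. \<epsilon> * real j * c j t) * E) \<le> L * Q" using L by (intro mult_left_mono) auto
    then show ?thesis by (simp add: sum_distrib_left sum_distrib_right mult_ac)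
  qed
  have expE: "exp (- real j * z) \<le> E" if "\<epsilon> * real j \<ge> \<delta>" for j
  proof -
    have "\<delta> / \<epsilon> \<le> real j" using that \<epsilon> by (simp add: field_simps)
    then have "\<delta> / \<epsilon> * z \<le> real j * z" using z by (intro mult_right_mono) auto
    then show ?thesis by (simp add: E_def)
  qed
  \<comment> \<open>\<open>L\<close> comes from \<open>1 \<le> \<epsilon> j / \<delta>\<close>, which makes constants linear in the size.\<close>
  have large: "k + exp z * b' j \<le> L * (\<epsilon> * real j)" if "j \<ge> 2" "\<epsilon> * real j \<ge> \<delta>" for j
  proof -
    have 1: "b' j \<le> K * (1 + \<epsilon> * real j)" using K \<epsilon> that(1) by (auto simp: b'_def)
    have 2: "1 \<le> \<epsilon> * real j / \<delta>" using that \<delta> by simp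
    have "k + exp z * b' j \<le> k + exp z * (K * (1 + \<epsilon> * real j))"
      using 1 by (intro add_left_mono mult_left_mono) auto
    also have "\<dots> = k * 1 + exp z * K * (1 + \<epsilon> * real j)" by simp
    also have "\<dots> \<le> k * (\<epsilon> * real j / \<delta>) + exp z * K * (\<epsilon> * real j / \<delta> + \<epsilon> * real j)"
      using 2 k K \<epsilon> by (intro add_mono mult_left_mono) auto
    also have "\<dots> = L * (\<epsilon> * real j)" using \<delta> by (simp add: L_def field_simps)
    finally show ?thesis .
  qed
  have "p * F t \<le> B"
  proof (rule le_of_relaxation_inequality[where y = "\<lambda>t. p * F t" and l = "\<theta> * p / \<epsilon>"])
    show "p * F 0 \<le> B" using init by (simp add: F_def p_def sum_distrib_left mult.assoc)
  next
    fix s assume s: "0 \<le> s" "s \<le> T"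
    obtain D where D: "(F has_real_derivative D) (at s within {0..})"
      and Dle: "\<epsilon> * D \<le> \<alpha> * (u s)\<^sup>2 * exp (- 2 * z)
        - (1 - exp (- z)) * (\<Sum>j=2..N. (u s * a j - exp z * b' j) * c j s * exp (- real j * z))
        + b (N + 1) * c (N + 1) s * exp (- real N * z)"
      using truncated_generating_function_deriv[OF sol s(1) N(1) \<epsilon>(1) \<open>\<beta> \<ge> 0\<close> a, of z]
      unfolding F_def b'_def by blast
    have summand: "(u s * a j - exp z * b' j) * c j s * exp (- real j * z)
        \<ge> k * p * (c j s * exp (- real j * z)) - L * E * (\<epsilon> * real j * c j s)"
      if j: "j \<ge> 2" for j
    proof (cases "\<epsilon> * real j < \<delta>")
      case True
      then have "k * p * (c j s * exp (- real j * z)) \<le> (u s * a j - exp z * b' j) * (c j s * exp (- real j * z))"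
        using small[OF s j] c[OF j s(1)] by (intro mult_right_mono) (auto simp: p_def b'_def)
      moreover have "0 \<le> L * E * (\<epsilon> * real j * c j s)"
        using L E \<epsilon> c[OF j s(1)] by auto
      ultimately show ?thesis by (simp only: mult.assoc)
    next
      case False
      have "k * p \<le> k" using k p by auto
      then have "k * p - (u s * a j - exp z * b' j) \<le> L * (\<epsilon> * real j)"
        using False large[OF j] a[OF j] u0[OF s(1)] by (smt (verit) mult_nonneg_nonneg)
      then have "(k * p - (u s * a j - exp z * b' j)) * (c j s * exp (- real j * z))
          \<le> L * (\<epsilon> * real j) * (c j s * exp (- real j * z))"
        using c[OF j s(1)] by (intro mult_right_mono) auto
      also have "\<dots> \<le> L * (\<epsilon> * real j) * (c j s * E)"
        using c[OF j s(1)] L \<epsilon> False expE[of j] by (intro mult_left_mono) auto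
      finally show ?thesis by (simp add: algebra_simps)
    qed
    have "k * (p * F s) - L * Q \<le>
        (\<Sum>j=2..N. k * p * (c j s * exp (- real j * z)) - L * E * (\<epsilon> * real j * c j s))"
      using mass[OF s(1), of "{2..N}"] by (simp add: sum_subtractf F_def sum_distrib_left mult.assoc)
    also have "\<dots> \<le> (\<Sum>j=2..N. (u s * a j - exp z * b' j) * c j s * exp (- real j * z))"
      using summand by (intro sum_mono) auto
    finally have "(1 - exp (- z)) * (k * (p * F s) - L * Q)
        \<le> (1 - exp (- z)) * (\<Sum>j=2..N. (u s * a j - exp z * b' j) * c j s * exp (- real j * z))"
      using z by (intro mult_left_mono) auto
    moreover have "b (N + 1) * c (N + 1) s * exp (- real N * z) \<le> L * Q"
    proof -
      have N1: "\<epsilon> * real (N + 1) \<ge> \<delta>" using N \<epsilon> by (simp add: algebra_simps)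
      have "exp z * b (N + 1) \<le> L * (\<epsilon> * real (N + 1))"
        using large[of "N + 1"] N N1 k by (auto simp: b'_def)
      then have "exp z * b (N + 1) * (c (N + 1) s * exp (- real (N + 1) * z))
          \<le> L * (\<epsilon> * real (N + 1)) * (c (N + 1) s * exp (- real (N + 1) * z))"
        using c[of "N + 1", OF _ s(1)] N by (intro mult_right_mono) auto
      also have "\<dots> \<le> L * (\<epsilon> * real (N + 1)) * (c (N + 1) s * E)"
        using c[of "N + 1", OF _ s(1)] N L \<epsilon> expE[OF N1] by (intro mult_left_mono) auto
      also have "\<dots> \<le> L * Q" using mass[OF s(1), of "{N + 1}"] N by (simp add: mult_ac)
      also have "exp z * b (N + 1) * (c (N + 1) s * exp (- real (N + 1) * z))
          = b (N + 1) * c (N + 1) s * exp (- real N * z)"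
      proof -
        have "exp z * exp (- real (N + 1) * z) = exp (- real N * z)"
          unfolding exp_add[symmetric] by (rule arg_cong[where f = exp]) (simp add: algebra_simps)
        then show ?thesis by (simp add: mult.assoc mult.left_commute[of "exp z"])
      qed
      finally show ?thesis .
    qed
    moreover have "\<alpha> * (u s)\<^sup>2 * exp (- 2 * z) \<le> A * U\<^sup>2"
    proof -
      have "\<alpha> * (u s)\<^sup>2 \<le> A * U\<^sup>2"
        using A U[OF s] u0[OF s(1)] by (intro mult_mono power_mono) auto
      moreover have "\<alpha> * (u s)\<^sup>2 * exp (- 2 * z) \<le> \<alpha> * (u s)\<^sup>2 * 1"
        using A z by (intro mult_left_mono) auto
      ultimately show ?thesis by simp
    qed
    ultimately have "\<epsilon> * D \<le> A * U\<^sup>2 - (1 - exp (- z)) * (k * (p * F s) - L * Q) + L * Q"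
      using Dle by linarith
    also have "\<dots> = A * U\<^sup>2 + L * Q + (1 - exp (- z)) * (L * Q) - \<theta> * (p * F s)"
      by (simp add: \<theta>_def algebra_simps)
    also have "(1 - exp (- z)) * (L * Q) \<le> 1 * (L * Q)"
      using mass[OF s(1), of "{}"] by (intro mult_right_mono) auto
    also have "A * U\<^sup>2 + L * Q + 1 * (L * Q) \<le> \<theta> * B"
    proof -
      have "(A * U\<^sup>2 + 2 * L * Q) / \<theta> \<le> B" using B by (simp only: \<theta>_def L_def)
      then show ?thesis using \<theta> by (simp add: pos_divide_le_eq mult_ac)
    qed
    finally have "\<epsilon> * D \<le> \<theta> * (B - p * F s)" by (simp add: algebra_simps)
    then have "p * (\<epsilon> * D) \<le> p * (\<theta> * (B - p * F s))" using p by (intro mult_left_mono) auto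
    then have "p * D \<le> \<theta> * p / \<epsilon> * (B - p * F s)" using \<epsilon> by (simp add: field_simps)
    moreover have "((\<lambda>t. p * F t) has_real_derivative p * D) (at s within {0..})"
      using D by (rule DERIV_cmult)
    ultimately show "\<exists>D. ((\<lambda>t. p * F t) has_real_derivative D) (at s within {0..}) \<and>
        D \<le> \<theta> * p / \<epsilon> * (B - p * F s)" by blast
  qed (use t in auto)
  then show ?thesis by (simp add: F_def p_def sum_distrib_left mult.assoc)
qed

section \<open>Bounds between the generating function, moments and mass\<close>

text \<open>On the cell of \<open>j\<close>, which has length \<open>\<epsilon>\<close>, one has \<open>\<Phi> x \<ge> x \<ge> (j - 1/2) \<epsilon> \<ge> j \<epsilon> / 2\<close>; hence the
  factor 1/2.\<close>

lemma step_fun_moment_lower_bound: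
  fixes v :: "nat \<Rightarrow> real" and \<Phi> :: "real \<Rightarrow> real"
  assumes "\<epsilon> > 0" and v: "\<And>j. j \<ge> k \<Longrightarrow> v j \<ge> 0" and k: "k \<ge> 1"
    and \<Phi>: "\<And>x. x \<ge> X \<Longrightarrow> \<Phi> x \<ge> x"
    and S: "finite S" "S \<subseteq> {k..}" "\<And>j. j \<in> S \<Longrightarrow> (real j - 1/2) * \<epsilon> \<ge> X"
  shows "ennreal (\<Sum>j\<in>S. \<epsilon>\<^sup>2 * real j * v j / 2) \<le>
    (\<integral>\<^sup>+x\<in>{0..}. ennreal (\<Phi> x * step_fun k \<epsilon> v x) \<partial>lborel)"
proof -
  have meas: "cell \<epsilon> j \<in> sets lborel" "emeasure lborel (cell \<epsilon> j) = ennreal \<epsilon>" for j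
    using \<open>\<epsilon> > 0\<close> by (simp_all add: cell_def algebra_simps)
  have "ennreal (\<Sum>j\<in>S. \<epsilon>\<^sup>2 * real j * v j / 2) = (\<Sum>j\<in>S. ennreal (\<epsilon> * real j / 2 * v j) * emeasure lborel (cell \<epsilon> j))"
    unfolding meas using v S \<open>\<epsilon> > 0\<close>
    by (subst sum_ennreal[symmetric])
       (auto simp: subset_iff power2_eq_square mult_ac simp flip: ennreal_mult' intro!: sum.cong)
  also have "\<dots> = (\<integral>\<^sup>+x. (\<Sum>j\<in>S. ennreal (\<epsilon> * real j / 2 * v j) * indicator (cell \<epsilon> j) x) \<partial>lborel)"
    using meas(1) by (subst nn_integral_sum) (auto simp: nn_integral_cmult_indicator)
  also have "\<dots> \<le> (\<integral>\<^sup>+x\<in>{0..}. ennreal (\<Phi> x * step_fun k \<epsilon> v x) \<partial>lborel)"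
  proof (rule nn_integral_mono)
    fix x :: real
    show "(\<Sum>j\<in>S. ennreal (\<epsilon> * real j / 2 * v j) * indicator (cell \<epsilon> j) x)
        \<le> ennreal (\<Phi> x * step_fun k \<epsilon> v x) * indicator {0..} x"
    proof (cases "\<exists>i\<in>S. x \<in> cell \<epsilon> i")
      case True
      then obtain i where i: "i \<in> S" "x \<in> cell \<epsilon> i" by blast
      have ik: "i \<ge> k" using i S by auto
      \<comment> \<open>Cells are disjoint: the step function with values \<open>real j\<close> identifies the cell of a point.\<close>
      have "cell \<epsilon> j \<inter> cell \<epsilon> i = {}" if "j \<noteq> i" for j
        using that step_fun_on_cell[OF \<open>\<epsilon> > 0\<close>, of 0 j _ real]
          step_fun_on_cell[OF \<open>\<epsilon> > 0\<close>, of 0 i _ real] by fastforce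
      then have "(\<Sum>j\<in>S. ennreal (\<epsilon> * real j / 2 * v j) * indicator (cell \<epsilon> j) x)
          = (\<Sum>j\<in>{i}. ennreal (\<epsilon> * real j / 2 * v j) * indicator (cell \<epsilon> j) x)"
        using i S(1) by (intro sum.mono_neutral_right) (auto simp: indicator_def)
      also have "\<dots> = ennreal (\<epsilon> * real i / 2 * v i)" using i by simp
      also have "\<dots> \<le> ennreal (\<Phi> x * v i)"
      proof (intro ennreal_leI mult_right_mono)
        have "(real i - 1/2) * \<epsilon> \<le> x" using i(2) by (simp add: cell_def)
        moreover from this have "x \<le> \<Phi> x" using S(3)[OF i(1)] by (intro \<Phi>) auto
        moreover have "\<epsilon> * real i / 2 \<le> (real i - 1/2) * \<epsilon>"
          using ik k \<open>\<epsilon> > 0\<close> by (simp add: field_simps)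
        ultimately show "\<epsilon> * real i / 2 \<le> \<Phi> x" by linarith
      qed (use v ik in auto)
      also have "\<dots> = ennreal (\<Phi> x * step_fun k \<epsilon> v x) * indicator {0..} x"
      proof -
        have "0 \<le> (real i - 1/2) * \<epsilon>" using ik k \<open>\<epsilon> > 0\<close> by simp
        then have "x \<ge> 0" using i(2) by (simp add: cell_def)
        then show ?thesis using step_fun_on_cell[OF \<open>\<epsilon> > 0\<close> ik i(2)] by simp
      qed
      finally show ?thesis .
    qed (auto simp: indicator_def)
  qed
  finally show ?thesis .
qed

lemma partial_generating_function_le_BD_F:
  assumes "finite S" "S \<subseteq> {2..}" "\<And>j. j \<ge> 2 \<Longrightarrow> c j t \<ge> 0"
  shows "ennreal (\<Sum>j\<in>S. \<epsilon> powr r * c j t * exp (- real j * z)) \<le> BD_F r \<epsilon> c t z"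
proof -
  have "ennreal (\<Sum>j\<in>S. \<epsilon> powr r * c j t * exp (- real j * z))
      = (\<Sum>j\<in>S. ennreal (\<epsilon> powr r * c j t * exp (- real j * z)))"
    using assms by (subst sum_ennreal) auto
  also have "\<dots> \<le> BD_F r \<epsilon> c t z"
    unfolding BD_F_def using assms by (subst nonneg_infsum_complete) (auto intro!: SUP_upper)
  finally show ?thesis .
qed

lemma BD_F_le:
  assumes "\<And>j. j \<ge> 2 \<Longrightarrow> c j t \<ge> 0"
    and bound: "\<And>N. N \<ge> N0 \<Longrightarrow> (\<Sum>j=2..N. \<epsilon> powr r * c j t * exp (- real j * z)) \<le> B"
  shows "BD_F r \<epsilon> c t z \<le> ennreal B"
  unfolding BD_F_def
proof (rule infsum_le_finite_sums[OF nonneg_summable_on_complete])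
  fix S :: "nat set" assume S: "finite S" "S \<subseteq> {2..}"
  have "(\<Sum>j\<in>S. ennreal (\<epsilon> powr r * c j t * exp (- real j * z)))
      = ennreal (\<Sum>j\<in>S. \<epsilon> powr r * c j t * exp (- real j * z))"
    using assms(1) S by (subst sum_ennreal) auto
  also have "\<dots> \<le> ennreal B"
  proof (rule ennreal_leI)
    have "(\<Sum>j\<in>S. \<epsilon> powr r * c j t * exp (- real j * z))
        \<le> (\<Sum>j=2..max N0 (Max S). \<epsilon> powr r * c j t * exp (- real j * z))"
      using S assms(1) by (intro sum_mono2) (auto simp: le_max_iff_disj)
    then show "(\<Sum>j\<in>S. \<epsilon> powr r * c j t * exp (- real j * z)) \<le> B"
      using bound[of "max N0 (Max S)"] by simp
  qed
  finally show "(\<Sum>j\<in>S. ennreal (\<epsilon> powr r * c j t * exp (- real j * z))) \<le> ennreal B" .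
qed auto

text \<open>This bound degenerates as \<open>\<epsilon> \<rightarrow> 0\<close>; it serves for the finitely many terms of the sequence
  at which \<open>\<epsilon>\<close> is not yet small.\<close>

lemma BD_F_le_mass:
  assumes sol: "BD_solution \<eta> \<epsilon> \<alpha> \<beta> a b u c m" and "\<epsilon> > 0" "t \<ge> 0" "z \<ge> 0"
  shows "BD_F r \<epsilon> c t z \<le> ennreal (\<epsilon> powr r / \<epsilon>\<^sup>2 * m)"
proof (rule BD_F_le)
  show c: "c j t \<ge> 0" if "j \<ge> 2" for j using sol that \<open>t \<ge> 0\<close> unfolding BD_solution_def by auto
  fix N :: nat
  have u: "u t \<ge> 0" using sol \<open>t \<ge> 0\<close> unfolding BD_solution_def by auto
  have "(\<Sum>j=2..N. \<epsilon> powr r * c j t * exp (- real j * z)) \<le> (\<Sum>j=2..N. \<epsilon> powr r / \<epsilon>\<^sup>2 * (\<epsilon>\<^sup>2 * real j * c j t))"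
  proof (rule sum_mono)
    fix j assume j: "j \<in> {2..N}"
    have "\<epsilon> powr r * c j t * exp (- real j * z) \<le> \<epsilon> powr r * c j t * real j"
      using c[of j] j \<open>z \<ge> 0\<close>
      by (intro mult_left_mono order.trans[of "exp (- real j * z)" 1 "real j"]) auto
    then show "\<epsilon> powr r * c j t * exp (- real j * z) \<le> \<epsilon> powr r / \<epsilon>\<^sup>2 * (\<epsilon>\<^sup>2 * real j * c j t)"
      using \<open>\<epsilon> > 0\<close> by (simp add: mult_ac)
  qed
  also have "\<dots> = \<epsilon> powr r / \<epsilon>\<^sup>2 * (\<Sum>j=2..N. \<epsilon>\<^sup>2 * real j * c j t)"
    by (simp only: sum_distrib_left)
  also have "\<dots> \<le> \<epsilon> powr r / \<epsilon>\<^sup>2 * m"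
    using BD_solution_mass_partial[OF sol \<open>t \<ge> 0\<close>, of "{2..N}"] u by (intro mult_left_mono) auto
  finally show "(\<Sum>j=2..N. \<epsilon> powr r * c j t * exp (- real j * z)) \<le> \<epsilon> powr r / \<epsilon>\<^sup>2 * m" .
qed

lemma finite_SUP_ennreal_bound:
  fixes f :: "'a \<Rightarrow> ennreal"
  assumes "(SUP x\<in>A. f x) < \<infinity>"
  obtains M where "M \<ge> 0" "\<And>x. x \<in> A \<Longrightarrow> f x \<le> ennreal M"
proof
  show "enn2real (SUP x\<in>A. f x) \<ge> 0" by simp
  show "f x \<le> ennreal (enn2real (SUP x\<in>A. f x))" if "x \<in> A" for x
    using assms that by (simp add: SUP_upper)
qed

text \<open>Clusters of size at least \<open>X\<close>, where \<open>\<Phi> x \<ge> x\<close>, are controlled by the \<open>\<Phi>\<close>-moment. The others have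
  \<open>\<epsilon> j \<le> X + 1\<close>, so that \<open>exp (j z) \<le> exp (\<kappa> / \<epsilon>)\<close> as soon as \<open>(X + 1) z \<le> \<kappa>\<close>, and they are controlled
  by the generating function at this \<open>z\<close>.\<close>

lemma initial_mass_subexponential:
  fixes c :: "real \<Rightarrow> nat \<Rightarrow> real \<Rightarrow> real" and \<Phi> :: "real \<Rightarrow> real"
  assumes nonneg: "\<And>\<epsilon> j. \<epsilon> > 0 \<Longrightarrow> j \<ge> 2 \<Longrightarrow> c \<epsilon> j 0 \<ge> 0"
    and \<Phi>: "filterlim (\<lambda>x. \<Phi> x / x) at_top at_top"
    and moment: "(SUP \<epsilon>\<in>{0<..}. \<integral>\<^sup>+x\<in>{0..}. ennreal (\<Phi> x * step_fun 2 \<epsilon> (\<lambda>i. c \<epsilon> i 0) x) \<partial>lborel) < \<infinity>"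
    and F: "\<And>z. 0 < z \<Longrightarrow> z < 1 \<Longrightarrow> (SUP \<epsilon>\<in>{0<..}. BD_F r \<epsilon> (c \<epsilon>) 0 z) < \<infinity>"
    and "r \<le> 1" and "\<kappa> > 0"
  shows "\<exists>C\<ge>0. \<forall>\<epsilon> S. 0 < \<epsilon> \<longrightarrow> \<epsilon> \<le> 1 \<longrightarrow> finite S \<longrightarrow> S \<subseteq> {2..} \<longrightarrow>
    (\<Sum>j\<in>S. \<epsilon>\<^sup>2 * real j * c \<epsilon> j 0) \<le> C * exp (\<kappa> / \<epsilon>)"
proof -
  have "eventually (\<lambda>x. \<Phi> x / x \<ge> 1 \<and> x > 0) at_top"
    using \<Phi> eventually_gt_at_top[of 0] unfolding filterlim_at_top by (auto intro: eventually_conj)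
  then obtain X0 where X0: "\<And>x. x \<ge> X0 \<Longrightarrow> \<Phi> x / x \<ge> 1 \<and> x > 0"
    unfolding eventually_at_top_linorder by blast
  define X where "X = max X0 1"
  have X: "\<Phi> x \<ge> x" if "x \<ge> X" for x
    using X0[of x] that by (auto simp: X_def field_simps)
  have "X > 0" by (simp add: X_def)
  obtain M1 where M1: "M1 \<ge> 0" "\<And>\<epsilon>. \<epsilon> > 0 \<Longrightarrow>
      (\<integral>\<^sup>+x\<in>{0..}. ennreal (\<Phi> x * step_fun 2 \<epsilon> (\<lambda>i. c \<epsilon> i 0) x) \<partial>lborel) \<le> ennreal M1"
    using finite_SUP_ennreal_bound[OF moment] by auto
  define z where "z = min (\<kappa> / (X + 1)) (1/2)"
  have z: "0 < z" "z < 1" "z \<le> \<kappa> / (X + 1)"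
    using \<open>X > 0\<close> \<open>\<kappa> > 0\<close> by (auto simp: z_def)
  have Xz: "(X + 1) * z \<le> \<kappa>" using z(3) \<open>X > 0\<close> by (simp add: pos_le_divide_eq mult.commute)
  obtain M2 where M2: "M2 \<ge> 0" "\<And>\<epsilon>. \<epsilon> > 0 \<Longrightarrow> BD_F r \<epsilon> (c \<epsilon>) 0 z \<le> ennreal M2"
    using finite_SUP_ennreal_bound[OF F[OF z(1,2)]] by auto
  show ?thesis
  proof (intro exI[of _ "2 * M1 + (X + 1) * M2"] conjI allI impI)
    show "0 \<le> 2 * M1 + (X + 1) * M2" using M1 M2 \<open>X > 0\<close> by simp
    fix \<epsilon> :: real and S :: "nat set"
    assume \<epsilon>: "0 < \<epsilon>" "\<epsilon> \<le> 1" and S: "finite S" "S \<subseteq> {2..}"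
    define L where "L = {j\<in>S. (real j - 1/2) * \<epsilon> \<ge> X}"
    have L: "(\<Sum>j\<in>L. \<epsilon>\<^sup>2 * real j * c \<epsilon> j 0) \<le> 2 * M1"
    proof -
      have "ennreal (\<Sum>j\<in>L. \<epsilon>\<^sup>2 * real j * c \<epsilon> j 0 / 2) \<le> ennreal M1"
        using S nonneg[OF \<epsilon>(1)] X
        by (intro order.trans[OF step_fun_moment_lower_bound[where X = X] M1(2)[OF \<epsilon>(1)]] \<epsilon>)
           (auto simp: L_def)
      then show ?thesis using M1(1) by (simp add: sum_divide_distrib[symmetric])
    qed
    have "(\<Sum>j\<in>S - L. \<epsilon>\<^sup>2 * real j * c \<epsilon> j 0)
        \<le> (\<Sum>j\<in>S - L. (X + 1) * exp (\<kappa> / \<epsilon>) * (\<epsilon> powr r * c \<epsilon> j 0 * exp (- real j * z)))"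
    proof (rule sum_mono)
      fix j assume j: "j \<in> S - L"
      have cj: "c \<epsilon> j 0 \<ge> 0" using nonneg[OF \<epsilon>(1)] j S by auto
      have "\<not> X \<le> (real j - 1/2) * \<epsilon>" using j by (auto simp: L_def)
      then have jX: "\<epsilon> * real j \<le> X + 1" using \<epsilon> by (simp add: algebra_simps)
      have "\<epsilon> \<le> \<epsilon> powr r" using powr_mono'[of r 1 \<epsilon>] \<epsilon> \<open>r \<le> 1\<close> by simp
      moreover have "1 \<le> exp (\<kappa> / \<epsilon>) * exp (- real j * z)"
      proof -
        have "\<epsilon> * real j * z \<le> \<kappa>" using jX Xz z(1) by (meson mult_right_mono less_imp_le order.trans)
        then have "real j * z \<le> \<kappa> / \<epsilon>" using \<epsilon> by (simp add: field_simps)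
        then show ?thesis by (simp flip: exp_add)
      qed
      ultimately have "\<epsilon> * 1 \<le> \<epsilon> powr r * (exp (\<kappa> / \<epsilon>) * exp (- real j * z))"
        using \<epsilon> by (intro mult_mono) auto
      from mult_mono[OF jX this] have "(\<epsilon> * real j) * (\<epsilon> * 1) \<le> (X + 1) * (\<epsilon> powr r * (exp (\<kappa> / \<epsilon>) * exp (- real j * z)))"
        using \<epsilon> \<open>X > 0\<close> by simp
      then have "(\<epsilon> * real j) * (\<epsilon> * 1) * c \<epsilon> j 0
          \<le> (X + 1) * (\<epsilon> powr r * (exp (\<kappa> / \<epsilon>) * exp (- real j * z))) * c \<epsilon> j 0"
        using cj by (intro mult_right_mono)
      then show "\<epsilon>\<^sup>2 * real j * c \<epsilon> j 0
          \<le> (X + 1) * exp (\<kappa> / \<epsilon>) * (\<epsilon> powr r * c \<epsilon> j 0 * exp (- real j * z))"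
        by (simp add: power2_eq_square mult_ac)
    qed
    also have "\<dots> = (X + 1) * exp (\<kappa> / \<epsilon>) * (\<Sum>j\<in>S - L. \<epsilon> powr r * c \<epsilon> j 0 * exp (- real j * z))"
      by (simp only: sum_distrib_left)
    also have "\<dots> \<le> (X + 1) * exp (\<kappa> / \<epsilon>) * M2"
    proof (intro mult_left_mono)
      have "ennreal (\<Sum>j\<in>S - L. \<epsilon> powr r * c \<epsilon> j 0 * exp (- real j * z)) \<le> ennreal M2"
        using S nonneg[OF \<epsilon>(1)]
        by (intro order.trans[OF partial_generating_function_le_BD_F M2(2)[OF \<epsilon>(1)]]) auto
      then show "(\<Sum>j\<in>S - L. \<epsilon> powr r * c \<epsilon> j 0 * exp (- real j * z)) \<le> M2" using M2(1) by simp
    qed (use \<open>X > 0\<close> in auto)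
    finally have "(\<Sum>j\<in>S - L. \<epsilon>\<^sup>2 * real j * c \<epsilon> j 0) \<le> (X + 1) * M2 * exp (\<kappa> / \<epsilon>)"
      by (simp add: mult_ac)
    moreover have "(\<Sum>j\<in>S. \<epsilon>\<^sup>2 * real j * c \<epsilon> j 0)
        = (\<Sum>j\<in>S - L. \<epsilon>\<^sup>2 * real j * c \<epsilon> j 0) + (\<Sum>j\<in>L. \<epsilon>\<^sup>2 * real j * c \<epsilon> j 0)"
      using S by (intro sum.subset_diff) (auto simp: L_def)
    moreover have "2 * M1 * 1 \<le> 2 * M1 * exp (\<kappa> / \<epsilon>)"
      using M1 \<epsilon> \<open>\<kappa> > 0\<close> by (intro mult_left_mono) auto
    ultimately show "(\<Sum>j\<in>S. \<epsilon>\<^sup>2 * real j * c \<epsilon> j 0) \<le> (2 * M1 + (X + 1) * M2) * exp (\<kappa> / \<epsilon>)"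
      using L by (simp add: distrib_right)
  qed
qed

section \<open>Small clusters grow\<close>

text \<open>With \<open>\<rho> < \<rho>' < v\<close> and \<open>1 < w < v / \<rho>'\<close>, small sizes satisfy \<open>b \<le> \<rho>' a\<close> and \<open>exp z \<le> w\<close> when
  \<open>z < ln w\<close>, so \<open>v a - exp z b \<ge> \<sigma> a\<close> with \<open>\<sigma> = v - w \<rho>' > 0\<close>, and \<open>a\<close> is comparable to \<open>x\<close> to the
  power \<open>r\<^sub>a\<close>. The discrete rates differ from \<open>a\<close> and \<open>b\<close> by at most \<open>h\<close> times this power, because
  \<open>r\<^sub>a \<le> r\<^sub>b\<close>; \<open>h\<close> is chosen so that these errors use up half of the lower bound \<open>\<sigma> a\<^sub>0 / 2\<close>.\<close>

lemma small_cluster_net_growth: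
  fixes a b :: "real \<Rightarrow> real" and a\<^sub>\<epsilon> b\<^sub>\<epsilon> :: "real \<Rightarrow> nat \<Rightarrow> real"
  assumes r: "0 \<le> r\<^sub>a" "r\<^sub>a \<le> r\<^sub>b" and "a\<^sub>0 > 0"
    and a_pos: "\<And>x. x > 0 \<Longrightarrow> a x > 0"
    and a: "a \<sim>[at_right 0] (\<lambda>x. a\<^sub>0 * x powr r\<^sub>a)"
    and a\<^sub>\<epsilon>: "(\<lambda>(\<epsilon>, i). step_fun 2 \<epsilon> (a\<^sub>\<epsilon> \<epsilon>) (\<epsilon> * real i) - a (\<epsilon> * real i))
           \<in> o[size_to_0 2](\<lambda>(\<epsilon>, i). (\<epsilon> * real i) powr r\<^sub>a)"
    and b\<^sub>\<epsilon>: "(\<lambda>(\<epsilon>, i). step_fun 3 \<epsilon> (b\<^sub>\<epsilon> \<epsilon>) (\<epsilon> * real i) - b (\<epsilon> * real i))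
           \<in> o[size_to_0 3](\<lambda>(\<epsilon>, i). (\<epsilon> * real i) powr r\<^sub>b)"
    and \<rho>: "((\<lambda>x. b x / a x) \<longlongrightarrow> \<rho>) (at_right 0)" and "\<rho> \<ge> 0" and v: "v > \<rho>"
  shows "\<exists>\<delta>>0. \<exists>k>0. \<exists>z\<^sub>0>0. \<forall>\<epsilon> j z. 0 < \<epsilon> \<longrightarrow> 2 \<le> j \<longrightarrow> \<epsilon> * real j < \<delta> \<longrightarrow> z < z\<^sub>0 \<longrightarrow>
    k * \<epsilon> powr r\<^sub>a \<le> v * a\<^sub>\<epsilon> \<epsilon> j - exp z * (if j = 2 then 0 else b\<^sub>\<epsilon> \<epsilon> j)"
proof -
  define \<rho>' where "\<rho>' = (\<rho> + v) / 2"
  define w where "w = (v / \<rho>' + 1) / 2"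
  define \<sigma> where "\<sigma> = v - w * \<rho>'"
  have \<rho>': "\<rho> < \<rho>'" "0 < \<rho>'" "\<rho>' < v" using v \<open>\<rho> \<ge> 0\<close> by (auto simp: \<rho>'_def)
  have w: "w > 1" using \<rho>' by (simp add: w_def field_simps)
  have \<sigma>: "\<sigma> > 0" using \<rho>' by (simp add: \<sigma>_def w_def field_simps)
  define h where "h = \<sigma> * a\<^sub>0 / (4 * (v + w))"
  have h: "h > 0" using \<sigma> \<open>a\<^sub>0 > 0\<close> w \<rho>' by (auto simp: h_def intro!: divide_pos_pos)
  have half: "1/2 < (1::real)" by simp
  have ha: "eventually (\<lambda>x. a x \<ge> a\<^sub>0 / 2 * x powr r\<^sub>a) (at_right 0)"
    using asymp_equiv_imp_eventually_ge[OF a half] eventually_at_right_less[of 0]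
    by eventually_elim (use \<open>a\<^sub>0 > 0\<close> a_pos in \<open>auto simp: abs_mult abs_of_pos\<close>)
  have hb: "eventually (\<lambda>x. b x \<le> \<rho>' * a x) (at_right 0)"
    using order_tendstoD(2)[OF \<rho> \<rho>'(1)] eventually_at_right_less[of 0]
    by eventually_elim (use a_pos in \<open>auto simp: divide_less_eq intro: less_imp_le\<close>)
  obtain \<delta>1 where \<delta>1: "\<delta>1 > 0" "\<And>x. 0 < x \<Longrightarrow> x < \<delta>1 \<Longrightarrow> a x \<ge> a\<^sub>0 / 2 * x powr r\<^sub>a \<and> b x \<le> \<rho>' * a x"
    using eventually_conj[OF ha hb] unfolding eventually_at_right_field by auto
  obtain \<delta>2 where \<delta>2: "\<delta>2 > 0" "\<And>\<epsilon> i. \<epsilon> > 0 \<Longrightarrow> i \<ge> 2 \<Longrightarrow> \<epsilon> * real i < \<delta>2 \<Longrightarrow>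
      \<bar>a\<^sub>\<epsilon> \<epsilon> i - a (\<epsilon> * real i)\<bar> \<le> h * (\<epsilon> * real i) powr r\<^sub>a"
    using landau_o.smallD[OF a\<^sub>\<epsilon> h] unfolding eventually_size_to_0
    by (auto simp: step_fun_midpoint)
  obtain \<delta>3 where \<delta>3: "\<delta>3 > 0" "\<And>\<epsilon> i. \<epsilon> > 0 \<Longrightarrow> i \<ge> 3 \<Longrightarrow> \<epsilon> * real i < \<delta>3 \<Longrightarrow>
      \<bar>b\<^sub>\<epsilon> \<epsilon> i - b (\<epsilon> * real i)\<bar> \<le> h * (\<epsilon> * real i) powr r\<^sub>b"
    using landau_o.smallD[OF b\<^sub>\<epsilon> h] unfolding eventually_size_to_0
    by (auto simp: step_fun_midpoint)
  have "k * \<epsilon> powr r\<^sub>a \<le> v * a\<^sub>\<epsilon> \<epsilon> j - exp z * (if j = 2 then 0 else b\<^sub>\<epsilon> \<epsilon> j)"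
    if k: "k = \<sigma> * a\<^sub>0 / 4" and \<epsilon>: "0 < \<epsilon>" and j: "2 \<le> j"
      and small: "\<epsilon> * real j < min (min \<delta>1 1) (min \<delta>2 \<delta>3)" and z: "z < ln w" for k \<epsilon> z j
  proof -
    have lt: "\<epsilon> * real j < \<delta>1" "\<epsilon> * real j < 1" "\<epsilon> * real j < \<delta>2" "\<epsilon> * real j < \<delta>3"
      using small by auto
    define x where "x = \<epsilon> * real j"
    define X where "X = x powr r\<^sub>a"
    define B where "B = (if j = 2 then 0 else b\<^sub>\<epsilon> \<epsilon> j)"
    have x: "0 < x" "x < 1" "\<epsilon> \<le> x" using \<epsilon> j lt by (auto simp: x_def)
    have ax: "a x \<ge> a\<^sub>0 / 2 * X" "b x \<le> \<rho>' * a x" using \<delta>1(2)[of x] x lt by (auto simp: x_def X_def)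
    have aj: "a\<^sub>\<epsilon> \<epsilon> j \<ge> a x - h * X" using \<delta>2(2)[OF \<epsilon> j lt(3)] by (auto simp: x_def X_def)
    have B: "B \<le> \<rho>' * a x + h * X"
    proof (cases "j = 2")
      case True
      then show ?thesis using \<rho>' a_pos[OF x(1)] h by (simp add: B_def X_def)
    next
      case False
      have "b\<^sub>\<epsilon> \<epsilon> j \<le> b x + h * x powr r\<^sub>b" using \<delta>3(2)[of \<epsilon> j] \<epsilon> j False lt by (auto simp: x_def)
      also have "x powr r\<^sub>b \<le> X" unfolding X_def using x r by (intro powr_mono') auto
      finally show ?thesis using ax h False by (simp add: B_def)
    qed
    have "exp z < exp (ln w)" using z by (rule exp_less_mono)
    then have "exp z \<le> w" using w by simp
    have "exp z * B \<le> exp z * (\<rho>' * a x + h * X)" using B by (intro mult_left_mono) auto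
    also have "\<dots> \<le> w * (\<rho>' * a x + h * X)"
      using \<open>exp z \<le> w\<close> \<rho>' h a_pos[OF x(1)] by (intro mult_right_mono add_nonneg_nonneg) (auto simp: X_def)
    finally have 1: "exp z * B \<le> w * (\<rho>' * a x + h * X)" .
    have 2: "v * (a x - h * X) \<le> v * a\<^sub>\<epsilon> \<epsilon> j" using aj \<rho>' by (intro mult_left_mono) auto
    have "\<sigma> * a\<^sub>0 / 4 * \<epsilon> powr r\<^sub>a \<le> \<sigma> * a\<^sub>0 / 4 * X"
      unfolding X_def using \<sigma> \<open>a\<^sub>0 > 0\<close> x r \<epsilon> by (intro mult_left_mono powr_mono2) auto
    also have "\<dots> = \<sigma> * (a\<^sub>0 / 2 * X) - (v + w) * h * X"
      using w \<rho>' by (simp add: h_def field_simps)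
    also have "\<dots> \<le> \<sigma> * a x - (v + w) * h * X"
      using ax \<sigma> by (intro diff_right_mono mult_left_mono) auto
    also have "\<dots> = v * (a x - h * X) - w * (\<rho>' * a x + h * X)"
      by (simp add: \<sigma>_def algebra_simps)
    also have "\<dots> \<le> v * a\<^sub>\<epsilon> \<epsilon> j - exp z * B" using 1 2 by linarith
    finally show ?thesis by (simp only: B_def k)
  qed
  moreover have "min (min \<delta>1 1) (min \<delta>2 \<delta>3) > 0" "\<sigma> * a\<^sub>0 / 4 > 0" "ln w > 0"
    using \<delta>1 \<delta>2 \<delta>3 \<sigma> \<open>a\<^sub>0 > 0\<close> w by auto
  ultimately show ?thesis by blast
qed

section \<open>Uniform bound along the sequence\<close>

lemma SUP_finite_if_eventually_bounded:
  fixes f :: "nat \<Rightarrow> ennreal"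
  assumes "\<And>n. f n < \<infinity>" and "eventually (\<lambda>n. f n \<le> ennreal B) sequentially"
  shows "(SUP n. f n) < \<infinity>"
proof -
  obtain N where N: "\<And>n. n \<ge> N \<Longrightarrow> f n \<le> ennreal B"
    using assms(2) unfolding eventually_sequentially by blast
  have "f n \<le> ennreal B + (\<Sum>i<N. f i)" for n
  proof (cases "n < N")
    case True
    then have "f n \<le> (\<Sum>i<N. f i)" by (intro member_le_sum) auto
    then show ?thesis by (meson add_increasing zero_le)
  next
    case False
    then show ?thesis using N[of n] by (simp add: add_increasing2)
  qed
  then have "(SUP n. f n) \<le> ennreal B + (\<Sum>i<N. f i)" by (intro SUP_least)
  also have "\<dots> < \<infinity>" using assms(1) by (simp add: ennreal_add_less_top)
  finally show ?thesis .
qed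

theorem proposition2:
  fixes \<eta> :: real
    and \<alpha>\<^sub>\<epsilon> \<beta>\<^sub>\<epsilon> m\<^sub>\<epsilon> :: "real \<Rightarrow> real"
    and a\<^sub>\<epsilon> b\<^sub>\<epsilon> :: "real \<Rightarrow> nat \<Rightarrow> real"
    and u\<^sub>\<epsilon> :: "real \<Rightarrow> real \<Rightarrow> real"
    and c\<^sub>\<epsilon> :: "real \<Rightarrow> nat \<Rightarrow> real \<Rightarrow> real"
    and \<alpha> \<beta> K\<^sub>a K\<^sub>b r\<^sub>a r\<^sub>b a\<^sub>0 b\<^sub>0 \<rho> u_in T :: real
    and a b u :: "real \<Rightarrow> real"
    and \<mu>_in :: "real measure"
    and e :: "nat \<Rightarrow> real"
  assumes "\<eta> \<ge> 0"
    \<comment> \<open>the rescaled system, for each \<open>\<epsilon> > 0\<close>\<close>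
    and "\<And>\<epsilon>. \<epsilon> > 0 \<Longrightarrow> \<alpha>\<^sub>\<epsilon> \<epsilon> > 0"
    and "\<And>\<epsilon>. \<epsilon> > 0 \<Longrightarrow> \<beta>\<^sub>\<epsilon> \<epsilon> > 0"
    and "\<And>\<epsilon> i. \<epsilon> > 0 \<Longrightarrow> i \<ge> 2 \<Longrightarrow> a\<^sub>\<epsilon> \<epsilon> i > 0"
    and "\<And>\<epsilon> i. \<epsilon> > 0 \<Longrightarrow> i \<ge> 3 \<Longrightarrow> b\<^sub>\<epsilon> \<epsilon> i > 0"
    and "\<And>\<epsilon>. \<epsilon> > 0 \<Longrightarrow> \<exists>K>0. (\<forall>i\<ge>2. a\<^sub>\<epsilon> \<epsilon> (i + 1) - a\<^sub>\<epsilon> \<epsilon> i \<le> K) \<and>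
                              (\<forall>i\<ge>3. b\<^sub>\<epsilon> \<epsilon> i - b\<^sub>\<epsilon> \<epsilon> (i + 1) \<le> K)"
    and "\<And>\<epsilon>. \<epsilon> > 0 \<Longrightarrow>
          BD_solution \<eta> \<epsilon> (\<alpha>\<^sub>\<epsilon> \<epsilon>) (\<beta>\<^sub>\<epsilon> \<epsilon>) (a\<^sub>\<epsilon> \<epsilon>) (b\<^sub>\<epsilon> \<epsilon>) (u\<^sub>\<epsilon> \<epsilon>) (c\<^sub>\<epsilon> \<epsilon>) (m\<^sub>\<epsilon> \<epsilon>)"
    \<comment> \<open>assumptions on the rates\<close>
    and "\<alpha> > 0" and "\<beta> > 0"
    and "continuous_on {0..} a" and "continuous_on {0..} b"
    and "\<And>x. x \<ge> 0 \<Longrightarrow> a x \<ge> 0" and "\<And>x. x \<ge> 0 \<Longrightarrow> b x \<ge> 0"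
    and "\<And>x. x > 0 \<Longrightarrow> a x > 0" and "\<And>x. x > 0 \<Longrightarrow> b x > 0"
    and "(\<alpha>\<^sub>\<epsilon> \<longlongrightarrow> \<alpha>) (at_right 0)" and "(\<beta>\<^sub>\<epsilon> \<longlongrightarrow> \<beta>) (at_right 0)"
    and "\<And>C. compact C \<Longrightarrow> C \<subseteq> {0..} \<Longrightarrow>
          uniform_limit C (\<lambda>\<epsilon>. step_fun 2 \<epsilon> (a\<^sub>\<epsilon> \<epsilon>)) a (at_right 0)"
    and "\<And>C. compact C \<Longrightarrow> C \<subseteq> {0..} \<Longrightarrow>
          uniform_limit C (\<lambda>\<epsilon>. step_fun 3 \<epsilon> (b\<^sub>\<epsilon> \<epsilon>)) b (at_right 0)"
    and "K\<^sub>a > 0" and "K\<^sub>b > 0"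
    and "\<And>\<epsilon> x. \<epsilon> > 0 \<Longrightarrow> x \<ge> 0 \<Longrightarrow> step_fun 2 \<epsilon> (a\<^sub>\<epsilon> \<epsilon>) x \<le> K\<^sub>a * (1 + x)"
    and "\<And>\<epsilon> x. \<epsilon> > 0 \<Longrightarrow> x \<ge> 0 \<Longrightarrow> step_fun 3 \<epsilon> (b\<^sub>\<epsilon> \<epsilon>) x \<le> K\<^sub>b * (1 + x)"
    and "0 \<le> r\<^sub>a" and "r\<^sub>a < 1" and "r\<^sub>a \<le> r\<^sub>b" and "a\<^sub>0 > 0" and "b\<^sub>0 > 0"
    and "a \<sim>[at_right 0] (\<lambda>x. a\<^sub>0 * x powr r\<^sub>a)"
    and "b \<sim>[at_right 0] (\<lambda>x. b\<^sub>0 * x powr r\<^sub>b)"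
    and "(\<lambda>(\<epsilon>, i). step_fun 2 \<epsilon> (a\<^sub>\<epsilon> \<epsilon>) (\<epsilon> * real i) - a (\<epsilon> * real i))
           \<in> o[size_to_0 2](\<lambda>(\<epsilon>, i). (\<epsilon> * real i) powr r\<^sub>a)"
    and "(\<lambda>(\<epsilon>, i). step_fun 3 \<epsilon> (b\<^sub>\<epsilon> \<epsilon>) (\<epsilon> * real i) - b (\<epsilon> * real i))
           \<in> o[size_to_0 3](\<lambda>(\<epsilon>, i). (\<epsilon> * real i) powr r\<^sub>b)"
    and "((\<lambda>x. b x / a x) \<longlongrightarrow> \<rho>) (at_right 0)"
    \<comment> \<open>assumptions on the initial data\<close>
    and "u_in > \<rho>"
    and "\<mu>_in \<in> finite_borel_measures {0..}"
    and "((\<lambda>\<epsilon>. u\<^sub>\<epsilon> \<epsilon> 0) \<longlongrightarrow> u_in) (at_right 0)"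
    and "weak_star_tendsto {0..}
          (\<lambda>\<epsilon>. density_on {0..} (step_fun 2 \<epsilon> (\<lambda>i. c\<^sub>\<epsilon> \<epsilon> i 0))) \<mu>_in (at_right 0)"
    and "\<exists>\<Phi>\<in>superlinear_class.
          (SUP \<epsilon>\<in>{0<..}. \<integral>\<^sup>+x\<in>{0..}. ennreal (\<Phi> x * step_fun 2 \<epsilon> (\<lambda>i. c\<^sub>\<epsilon> \<epsilon> i 0) x) \<partial>lborel) < \<infinity>"
    and "\<And>z. 0 < z \<Longrightarrow> z < 1 \<Longrightarrow> (SUP \<epsilon>\<in>{0<..}. BD_F r\<^sub>a \<epsilon> (c\<^sub>\<epsilon> \<epsilon>) 0 z) < \<infinity>"
    \<comment> \<open>the sequence and its limit\<close>
    and "T > 0"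
    and "\<And>n. e n > 0" and "e \<longlonglongrightarrow> 0"
    and "uniform_limit {0..T} (\<lambda>n. u\<^sub>\<epsilon> (e n)) u sequentially"
    and "(INF t\<in>{0..T}. u t) > \<rho>"
  shows "(\<exists>z\<^sub>0>0. \<forall>z\<in>{0<..<z\<^sub>0}.
            (SUP n. SUP t\<in>{0..T}. BD_F r\<^sub>a (e n) (c\<^sub>\<epsilon> (e n)) t z) < \<infinity>) \<and>
         (\<forall>r\<ge>r\<^sub>a. \<forall>i\<ge>2.
            (SUP n. SUP t\<in>{0..T}. ennreal (e n powr r * c\<^sub>\<epsilon> (e n) i t)) < \<infinity>)"
proof -
  note \<alpha>_pos = assms(2) and \<beta>_pos = assms(3) and a_pos = assms(4) and sol = assms(7)
    and b_bound = assms(23) and initial_F = assms(39) and e_pos = assms(41)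
  have c_nonneg: "c\<^sub>\<epsilon> \<epsilon> i t \<ge> 0" if "\<epsilon> > 0" "i \<ge> 2" "t \<ge> 0" for \<epsilon> i t
    using sol[OF that(1)] that unfolding BD_solution_def by auto
  have e_lim: "filterlim e (at_right 0) sequentially"
    using assms(42) by (rule tendsto_imp_filterlim_at_right) (simp add: e_pos)
  have u_close: "eventually (\<lambda>n. \<forall>t\<in>{0..T}. \<bar>u\<^sub>\<epsilon> (e n) t - u t\<bar> < d) sequentially" if "d > 0" for d
    using assms(43) that unfolding uniform_limit_iff dist_real_def by auto

  obtain U where U: "eventually (\<lambda>n. \<forall>t\<in>{0..T}. u\<^sub>\<epsilon> (e n) t \<le> U) sequentially"
    and u_le: "\<And>t. t \<in> {0..T} \<Longrightarrow> \<bar>u t\<bar> \<le> U"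
  proof -
    obtain n0 where n0: "\<And>n t. n \<ge> n0 \<Longrightarrow> t \<in> {0..T} \<Longrightarrow> \<bar>u\<^sub>\<epsilon> (e n) t - u t\<bar> < 1"
      using u_close[OF zero_less_one] unfolding eventually_sequentially by blast
    have "continuous_on {0..T} (u\<^sub>\<epsilon> (e n0))"
      using sol[OF e_pos[of n0]] unfolding BD_solution_def by (auto intro: continuous_on_subset)
    then have "bounded (u\<^sub>\<epsilon> (e n0) ` {0..T})" by (intro compact_imp_bounded compact_continuous_image) auto
    then have "\<exists>C. \<forall>t\<in>{0..T}. \<bar>u\<^sub>\<epsilon> (e n0) t\<bar> \<le> C" by (simp add: bounded_iff)
    then obtain C where C: "\<And>t. t \<in> {0..T} \<Longrightarrow> \<bar>u\<^sub>\<epsilon> (e n0) t\<bar> \<le> C" by blast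
    have "\<bar>u t\<bar> \<le> C + 2" if "t \<in> {0..T}" for t using C[OF that] n0[OF order_refl that] by linarith
    moreover have "u\<^sub>\<epsilon> (e n) t \<le> C + 2" if "n \<ge> n0" "t \<in> {0..T}" for n t
      using C[OF that(2)] n0[OF that] n0[OF order_refl that(2)] by linarith
    ultimately show thesis using that[of "C + 2"] unfolding eventually_sequentially by blast
  qed
  have U_nonneg: "U \<ge> 0" using u_le[of 0] assms(40) by auto

  have "\<rho> \<ge> 0"
  proof (rule tendsto_lowerbound[OF assms(33)])
    show "\<forall>\<^sub>F x in at_right 0. 0 \<le> b x / a x"
      using eventually_at_right_less[of 0]
      by eventually_elim (use assms(12,13) in \<open>auto intro!: divide_nonneg_nonneg\<close>)
  qed auto

  obtain v where v: "\<rho> < v" "v < (INF t\<in>{0..T}. u t)" using assms(44) dense by blast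
  \<comment> \<open>An infimum of reals is a lower bound only if one exists; boundedness of \<open>u\<close> comes from the
    uniform limit.\<close>
  have u_ge: "eventually (\<lambda>n. \<forall>t\<in>{0..T}. v \<le> u\<^sub>\<epsilon> (e n) t) sequentially"
  proof -
    let ?I = "INF t\<in>{0..T}. u t"
    have "- U \<le> u t" if "t \<in> {0..T}" for t using u_le[OF that] by linarith
    then have "bdd_below (u ` {0..T})" by (rule bdd_belowI2)
    then have inf_le: "?I \<le> u t" if "t \<in> {0..T}" for t using that by (rule cINF_lower)
    have "eventually (\<lambda>n. \<forall>t\<in>{0..T}. \<bar>u\<^sub>\<epsilon> (e n) t - u t\<bar> < ?I - v) sequentially"
      using v(2) by (intro u_close) simp
    then show ?thesis
    proof (rule eventually_mono, intro ballI)
      fix n t assume close: "\<forall>t\<in>{0..T}. \<bar>u\<^sub>\<epsilon> (e n) t - u t\<bar> < ?I - v" and t: "t \<in> {0..T}"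
      show "v \<le> u\<^sub>\<epsilon> (e n) t" using bspec[OF close t] inf_le[OF t] by linarith
    qed
  qed

  obtain \<delta> k z\<^sub>1 where \<delta>: "\<delta> > 0" and k: "k > 0" and z\<^sub>1: "z\<^sub>1 > 0"
    and growth: "\<And>\<epsilon> j z. 0 < \<epsilon> \<Longrightarrow> 2 \<le> j \<Longrightarrow> \<epsilon> * real j < \<delta> \<Longrightarrow> z < z\<^sub>1 \<Longrightarrow>
      k * \<epsilon> powr r\<^sub>a \<le> v * a\<^sub>\<epsilon> \<epsilon> j - exp z * (if j = 2 then 0 else b\<^sub>\<epsilon> \<epsilon> j)"
    using small_cluster_net_growth[OF assms(24,26,27) assms(14,29,31,32,33) \<open>\<rho> \<ge> 0\<close> v(1)]
    by metis

  define z\<^sub>0 where "z\<^sub>0 = min z\<^sub>1 1"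
  have z\<^sub>0: "z\<^sub>0 > 0" "z\<^sub>0 \<le> z\<^sub>1" "z\<^sub>0 \<le> 1" using z\<^sub>1 by (auto simp: z\<^sub>0_def)
  have F_finite: "(SUP n. SUP t\<in>{0..T}. BD_F r\<^sub>a (e n) (c\<^sub>\<epsilon> (e n)) t z) < \<infinity>"
    if z: "z \<in> {0<..<z\<^sub>0}" for z
  proof -
    \<comment> \<open>Half of the decay of \<open>exp (-\<delta> z / \<epsilon>)\<close> compensates the mass, the other half the factor
      \<open>1 / \<epsilon>\<close>.\<close>
    define \<kappa> where "\<kappa> = \<delta> * z / 2"
    have \<kappa>: "\<kappa> > 0" using \<delta> z by (simp add: \<kappa>_def)
    obtain \<Phi> where \<Phi>: "filterlim (\<lambda>x. \<Phi> x / x) at_top at_top"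
      and moment: "(SUP \<epsilon>\<in>{0<..}. \<integral>\<^sup>+x\<in>{0..}. ennreal (\<Phi> x * step_fun 2 \<epsilon> (\<lambda>i. c\<^sub>\<epsilon> \<epsilon> i 0) x) \<partial>lborel) < \<infinity>"
      using assms(38) unfolding superlinear_class_def by blast
    obtain C where C: "C \<ge> 0" and mass: "\<And>\<epsilon> S. 0 < \<epsilon> \<Longrightarrow> \<epsilon> \<le> 1 \<Longrightarrow> finite S \<Longrightarrow> S \<subseteq> {2..} \<Longrightarrow>
        (\<Sum>j\<in>S. \<epsilon>\<^sup>2 * real j * c\<^sub>\<epsilon> \<epsilon> j 0) \<le> C * exp (\<kappa> / \<epsilon>)"
      using initial_mass_subexponential[OF c_nonneg[OF _ _ order_refl] \<Phi> moment initial_F less_imp_le[OF assms(25)] \<kappa>]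
      by blast
    obtain M where M: "M \<ge> 0" "\<And>\<epsilon>. \<epsilon> > 0 \<Longrightarrow> BD_F r\<^sub>a \<epsilon> (c\<^sub>\<epsilon> \<epsilon>) 0 z \<le> ennreal M"
      using finite_SUP_ennreal_bound[OF initial_F[of z]] z z\<^sub>0 by auto
    define Q where "Q = (U + C) / \<kappa>"
    define A where "A = \<alpha> + 1"
    define B where "B = max M ((A * U\<^sup>2 + 2 * ((k + exp z * K\<^sub>b * (1 + \<delta>)) / \<delta>) * Q) / ((1 - exp (- z)) * k))"
    have \<alpha>_le: "eventually (\<lambda>n. \<alpha>\<^sub>\<epsilon> (e n) \<le> A) sequentially"
      using order_tendstoD(2)[OF filterlim_compose[OF assms(16) e_lim], of A]
      by (auto simp: A_def elim!: eventually_mono)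
    have e_le: "eventually (\<lambda>n. e n \<le> 1) sequentially"
      using order_tendstoD(2)[OF assms(42), of 1] by (auto elim!: eventually_mono)
    have "eventually (\<lambda>n. (SUP t\<in>{0..T}. BD_F r\<^sub>a (e n) (c\<^sub>\<epsilon> (e n)) t z) \<le> ennreal B) sequentially"
      using U u_ge \<alpha>_le e_le
    proof eventually_elim
      case (elim n)
      define \<epsilon> where "\<epsilon> = e n"
      have \<epsilon>: "0 < \<epsilon>" "\<epsilon> \<le> 1" using e_pos elim by (auto simp: \<epsilon>_def)
      have Q: "m\<^sub>\<epsilon> \<epsilon> / \<epsilon> * exp (- \<delta> * z / \<epsilon>) \<le> Q"
      proof -
        have "(\<lambda>i. \<epsilon>\<^sup>2 * real i * c\<^sub>\<epsilon> \<epsilon> i 0) summable_on {2..}"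
          and m: "u\<^sub>\<epsilon> \<epsilon> 0 + (\<Sum>\<^sub>\<infinity>i\<in>{2..}. \<epsilon>\<^sup>2 * real i * c\<^sub>\<epsilon> \<epsilon> i 0) = m\<^sub>\<epsilon> \<epsilon>"
          using sol[OF \<epsilon>(1)] unfolding BD_solution_def by auto
        then have "(\<Sum>\<^sub>\<infinity>i\<in>{2..}. \<epsilon>\<^sup>2 * real i * c\<^sub>\<epsilon> \<epsilon> i 0) \<le> C * exp (\<kappa> / \<epsilon>)"
          using mass[OF \<epsilon>] by (intro infsum_le_finite_sums) auto
        moreover have "u\<^sub>\<epsilon> \<epsilon> 0 \<le> U * exp (\<kappa> / \<epsilon>)"
        proof -
          have "u\<^sub>\<epsilon> \<epsilon> 0 \<le> U * 1" using elim assms(40) by (auto simp: \<epsilon>_def)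
          also have "\<dots> \<le> U * exp (\<kappa> / \<epsilon>)" using U_nonneg \<kappa> \<epsilon> by (intro mult_left_mono) auto
          finally show ?thesis .
        qed
        ultimately have "m\<^sub>\<epsilon> \<epsilon> \<le> (U + C) * exp (\<kappa> / \<epsilon>)" using m by (simp add: distrib_right)
        then have "m\<^sub>\<epsilon> \<epsilon> / \<epsilon> * exp (- \<delta> * z / \<epsilon>) \<le> (U + C) * exp (\<kappa> / \<epsilon>) / \<epsilon> * exp (- \<delta> * z / \<epsilon>)"
          using \<epsilon> by (intro mult_right_mono divide_right_mono) auto
        also have "\<dots> = (U + C) * (exp (- \<kappa> / \<epsilon>) / \<epsilon>)"
        proof -
          have "exp (\<kappa> / \<epsilon>) * exp (- \<delta> * z / \<epsilon>) = exp (- \<kappa> / \<epsilon>)"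
            unfolding exp_add[symmetric] \<kappa>_def by (rule arg_cong[where f = exp]) simp
          then show ?thesis by (simp add: mult.assoc)
        qed
        also have "\<dots> \<le> (U + C) * (1 / \<kappa>)"
        proof (intro mult_left_mono)
          have "\<kappa> / \<epsilon> \<le> exp (\<kappa> / \<epsilon>)" using exp_ge_add_one_self[of "\<kappa> / \<epsilon>"] by linarith
          then show "exp (- \<kappa> / \<epsilon>) / \<epsilon> \<le> 1 / \<kappa>" using \<epsilon> \<kappa> by (simp add: exp_minus field_simps)
        qed (use U_nonneg C in auto)
        finally show ?thesis by (simp add: Q_def)
      qed
      show ?case unfolding \<epsilon>_def[symmetric]
      proof (rule SUP_least)
        fix t assume t: "t \<in> {0..T}"
        show "BD_F r\<^sub>a \<epsilon> (c\<^sub>\<epsilon> \<epsilon>) t z \<le> ennreal B"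
        proof (rule BD_F_le[where ?N0.0 = "max 2 (nat \<lceil>\<delta> / \<epsilon>\<rceil>)"])
          fix N assume N: "max 2 (nat \<lceil>\<delta> / \<epsilon>\<rceil>) \<le> N"
          have "\<delta> / \<epsilon> \<le> real N" using N by linarith
          then have N\<delta>: "\<epsilon> * real N \<ge> \<delta>" using \<epsilon> by (simp add: field_simps)
          show "(\<Sum>j=2..N. \<epsilon> powr r\<^sub>a * c\<^sub>\<epsilon> \<epsilon> j t * exp (- real j * z)) \<le> B"
          proof (rule truncated_generating_function_bound[OF sol[OF \<epsilon>(1)] \<epsilon>,
                where A = A and U = U and T = T and K = K\<^sub>b and k = k and \<delta> = \<delta> and Q = Q])
            show "b\<^sub>\<epsilon> \<epsilon> j \<le> K\<^sub>b * (1 + \<epsilon> * real j)" if "j \<ge> 3" for j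
              using b_bound[OF \<epsilon>(1), of "\<epsilon> * real j"] \<epsilon> that by (simp add: step_fun_midpoint)
            show "k * \<epsilon> powr r\<^sub>a \<le> u\<^sub>\<epsilon> \<epsilon> s * a\<^sub>\<epsilon> \<epsilon> j - exp z * (if j = 2 then 0 else b\<^sub>\<epsilon> \<epsilon> j)"
              if "0 \<le> s" "s \<le> T" "j \<ge> 2" "\<epsilon> * real j < \<delta>" for s j
            proof -
              have "v * a\<^sub>\<epsilon> \<epsilon> j \<le> u\<^sub>\<epsilon> \<epsilon> s * a\<^sub>\<epsilon> \<epsilon> j"
                using elim(2) that a_pos[OF \<epsilon>(1), of j] by (intro mult_right_mono) (auto simp: \<epsilon>_def)
              then show ?thesis using growth[OF \<epsilon>(1) that(3,4), of z] z z\<^sub>0 by force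
            qed
            have "ennreal (\<Sum>j=2..N. \<epsilon> powr r\<^sub>a * c\<^sub>\<epsilon> \<epsilon> j 0 * exp (- real j * z)) \<le> ennreal M"
              using c_nonneg[OF \<epsilon>(1)]
              by (intro order.trans[OF partial_generating_function_le_BD_F M(2)[OF \<epsilon>(1)]]) auto
            then have "(\<Sum>j=2..N. \<epsilon> powr r\<^sub>a * c\<^sub>\<epsilon> \<epsilon> j 0 * exp (- real j * z)) \<le> M" using M(1) by simp
            then show "(\<Sum>j=2..N. \<epsilon> powr r\<^sub>a * c\<^sub>\<epsilon> \<epsilon> j 0 * exp (- real j * z)) \<le> B" by (simp add: B_def)
          qed (use \<alpha>_pos[OF \<epsilon>(1)] \<beta>_pos[OF \<epsilon>(1)] a_pos[OF \<epsilon>(1)] z \<delta> k elim assms(21,24) Q N N\<delta> t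
              in \<open>auto simp: \<epsilon>_def B_def intro: less_imp_le\<close>)
        qed (use c_nonneg[OF \<epsilon>(1)] t in auto)
      qed
    qed
    then show ?thesis
    proof (rule SUP_finite_if_eventually_bounded[rotated])
      fix n
      have "(SUP t\<in>{0..T}. BD_F r\<^sub>a (e n) (c\<^sub>\<epsilon> (e n)) t z) \<le> ennreal (e n powr r\<^sub>a / (e n)\<^sup>2 * m\<^sub>\<epsilon> (e n))"
        using z by (intro SUP_least BD_F_le_mass[OF sol[OF e_pos]] e_pos) auto
      then show "(SUP t\<in>{0..T}. BD_F r\<^sub>a (e n) (c\<^sub>\<epsilon> (e n)) t z) < \<infinity>"
        by (rule order.strict_trans1) simp
    qed
  qed
  moreover have "(SUP n. SUP t\<in>{0..T}. ennreal (e n powr r * c\<^sub>\<epsilon> (e n) i t)) < \<infinity>"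
    if r: "r \<ge> r\<^sub>a" and i: "i \<ge> 2" for r i
  proof -
    \<comment> \<open>A single coefficient is a term of the generating function at any admissible \<open>z\<close>.\<close>
    define z where "z = z\<^sub>0 / 2"
    have z: "z \<in> {0<..<z\<^sub>0}" using z\<^sub>0 by (simp add: z_def)
    define S where "S = (SUP n. SUP t\<in>{0..T}. BD_F r\<^sub>a (e n) (c\<^sub>\<epsilon> (e n)) t z)"
    obtain E where E: "\<And>n. e n \<le> E"
      using convergent_imp_Bseq[of e] assms(42) unfolding Bseq_def convergent_def
      by (metis abs_le_D1 real_norm_def)
    define D where "D = E powr (r - r\<^sub>a) * exp (real i * z)"
    have "ennreal (e n powr r * c\<^sub>\<epsilon> (e n) i t) \<le> ennreal D * S" if t: "t \<in> {0..T}" for n t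
    proof -
      have c: "c\<^sub>\<epsilon> (e n) i t \<ge> 0" using c_nonneg[OF e_pos i] t by auto
      have "e n powr r = e n powr (r - r\<^sub>a) * e n powr r\<^sub>a" by (simp flip: powr_add)
      also have "\<dots> \<le> E powr (r - r\<^sub>a) * e n powr r\<^sub>a"
        using r E[of n] e_pos[of n] by (intro mult_right_mono powr_mono2) auto
      finally have "e n powr r * c\<^sub>\<epsilon> (e n) i t \<le> E powr (r - r\<^sub>a) * e n powr r\<^sub>a * c\<^sub>\<epsilon> (e n) i t"
        using c by (rule mult_right_mono)
      also have "\<dots> = D * (e n powr r\<^sub>a * c\<^sub>\<epsilon> (e n) i t * exp (- real i * z))"
        by (simp add: D_def exp_minus field_simps)
      finally have "ennreal (e n powr r * c\<^sub>\<epsilon> (e n) i t)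
          \<le> ennreal (D * (e n powr r\<^sub>a * c\<^sub>\<epsilon> (e n) i t * exp (- real i * z)))"
        by (rule ennreal_leI)
      also have "\<dots> = ennreal D * ennreal (e n powr r\<^sub>a * c\<^sub>\<epsilon> (e n) i t * exp (- real i * z))"
        by (rule ennreal_mult') (simp add: D_def)
      also have "\<dots> \<le> ennreal D * S"
      proof (rule mult_left_mono)
        have "ennreal (e n powr r\<^sub>a * c\<^sub>\<epsilon> (e n) i t * exp (- real i * z)) \<le> BD_F r\<^sub>a (e n) (c\<^sub>\<epsilon> (e n)) t z"
          using partial_generating_function_le_BD_F[of "{i}" "c\<^sub>\<epsilon> (e n)" t "e n" r\<^sub>a z] i c_nonneg[OF e_pos] t by auto
        also have "\<dots> \<le> (SUP t\<in>{0..T}. BD_F r\<^sub>a (e n) (c\<^sub>\<epsilon> (e n)) t z)" using t by (rule SUP_upper)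
        also have "\<dots> \<le> S" unfolding S_def by (rule SUP_upper) simp
        finally show "ennreal (e n powr r\<^sub>a * c\<^sub>\<epsilon> (e n) i t * exp (- real i * z)) \<le> S" .
      qed simp
      finally show ?thesis .
    qed
    then have "(SUP n. SUP t\<in>{0..T}. ennreal (e n powr r * c\<^sub>\<epsilon> (e n) i t)) \<le> ennreal D * S"
      by (intro SUP_least)
    also have "\<dots> < \<infinity>"
      using F_finite[OF z] by (simp add: S_def ennreal_mult_less_top)
    finally show ?thesis .
  qed
  ultimately show ?thesis using z\<^sub>0(1) by blast
qed

end
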